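(* Let $n$ be a nonnegative integer. Then there is an extremal square-free circular word of length $n$ over the alphabet $\Gamma=\{\mathtt{a},\mathtt{b},\mathtt{c}\}$ if and only if \[ n\in\{4,6,8,13,15,16,18,20,21,22,23,24,28,30,32,33,34,35,36\}\cup\{m\colon m\geq 38\}. \]
   Context: A word is square-free if it contains no factor of the form $xx$ with $x$ nonempty. Words $u,v$ are conjugates if $u=xy$ and $v=yx$ for some words $x,y$. For a word $w$ over $\Sigma$, the circular word $\langle w\rangle$ is the set of all conjugates of $w$; its length is $|w|$. The circular word $\langle w\rangle$ is square-free if every conjugate of $w$ is square-free. An extension of $\langle w\rangle$ is a circular word $\langle w'aw''\rangle$ where $a\in\Sigma$ and $w=w'w''$. The circular word $\langle w\rangle$ is extremal square-free if $\langle w\rangle$ is square-free and every extension of $\langle w\rangle$ is not square-free (i.e., some conjugate of it contains a square). *)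

theory Defs
  imports Main "HOL-Library.Sublist"
begin

definition square_free :: "'a list \<Rightarrow> bool" where
  "square_free w \<longleftrightarrow> \<not> (\<exists>x. x \<noteq> [] \<and> sublist (x @ x) w)"

definition conjugate :: "'a list \<Rightarrow> 'a list \<Rightarrow> bool" where
  "conjugate u v \<longleftrightarrow> (\<exists>x y. u = x @ y \<and> v = y @ x)"

definition circular_word :: "'a list \<Rightarrow> 'a list set" where
  "circular_word w = {v. conjugate w v}"

definition circular_square_free :: "'a list set \<Rightarrow> bool" where
  "circular_square_free W \<longleftrightarrow> (\<forall>v\<in>W. square_free v)"

(* The alphabet is the whole type 'a.  The extensions of a circular word do not
   depend on the choice of the representative w' @ w'': inserting a letter into a
   conjugate of it yields a conjugate of one of the words w' @ [a] @ w''. *)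
definition extension :: "'a list set \<Rightarrow> 'a list set \<Rightarrow> bool" where
  "extension W W' \<longleftrightarrow>
     (\<exists>w' w'' a. W = circular_word (w' @ w'') \<and> W' = circular_word (w' @ [a] @ w''))"

definition extremal_square_free :: "'a list set \<Rightarrow> bool" where
  "extremal_square_free W \<longleftrightarrow>
     circular_square_free W \<and> (\<forall>W'. extension W W' \<longrightarrow> \<not> circular_square_free W')"

datatype letter = La | Lb | Lc

end

theory Submission
  imports Defs
begin

text \<open>
  Large lengths. There are three blocks of length 28, one for each letter, and for every residue
  class modulo 28 a connector of a length in this class. A connector followed by the
  images of the letters of a non-empty square-free word is, read circularly, square-free, because the
  blocks define a square-free morphism on four letters and the connector plays the role of
  a letter that occurs once. It is extremal because all blocks begin with the same marker, and
  inserting a letter into a block creates a square inside the block followed by the marker.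

  Gaps. Up to rotation and renaming of letters, a circular square-free word of length at
  least 6 begins with abcacbc, or it begins with abac and no conjugate contains a renaming of
  abcacbc. Both cases are excluded by exhaustive search.
\<close>

section \<open>Square-free morphisms\<close>

text \<open>A square-free ternary word of length k need not be square-free as a circular word. Hence
  the fourth letter: it occurs once in the circle, so no square can use it, and every square-free
  word can be closed up by it. Since the three blocks share the length 28, the length of the result
  depends only on the connector and on the number of letters, and 28 connectors cover all large
  lengths. The same blocks, iterated on a single letter, yield the square-free words that are fed
  in. The condition \<open>cut\<close> of the criterion is the one that defines ps-morphisms.
  Extremality is cheap to check because, between different neighbours, only the third letter has to
  be tried. Connectors have up to 72 letters; the lengths from 38 on that a connector with further
  blocks misses are covered by connectors alone and by five sporadic words. For the gaps the
  obstacle is the number of square-free words of length up to 37: the case distinction on abcacbc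
  either fixes seven letters or gives a pattern by which to prune.\<close>

lemma square_free_iff_nth:
  "square_free w \<longleftrightarrow>
     \<not> (\<exists>i q. 0 < q \<and> i + 2 * q \<le> length w \<and> (\<forall>r<q. w ! (i + r) = w ! (i + q + r)))"
proof -
  have "(\<exists>x. x \<noteq> [] \<and> sublist (x @ x) w) \<longleftrightarrow>
     (\<exists>i q. 0 < q \<and> i + 2 * q \<le> length w \<and> (\<forall>r<q. w ! (i + r) = w ! (i + q + r)))" (is "?L = ?R")
  proof
    assume ?L
    then obtain x p s where x: "x \<noteq> []" "w = p @ x @ x @ s"
      by (auto simp: sublist_def)
    have "w ! (length p + r) = w ! (length p + length x + r)" if "r < length x" for r
      using that by (simp add: x nth_append)
    then show ?R
      using x by (intro exI[of _ "length p"] exI[of _ "length x"]) auto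
  next
    assume ?R
    then obtain i q where q: "0 < q" "i + 2 * q \<le> length w"
      and eq: "\<And>r. r < q \<Longrightarrow> w ! (i + r) = w ! (i + q + r)" by blast
    let ?x = "take q (drop i w)"
    have x2: "?x = take q (drop (i + q) w)"
      using q eq by (intro nth_equalityI) auto
    have "drop i w = ?x @ take q (drop (i + q) w) @ drop (i + 2 * q) w"
      by (metis (no_types, lifting) append_take_drop_id drop_drop add.commute mult_2 add.assoc)
    then have "w = take i w @ (?x @ ?x) @ drop (i + 2 * q) w"
      by (metis x2 append.assoc append_take_drop_id)
    moreover have "?x \<noteq> []" using q by auto
    ultimately show ?L unfolding sublist_def by blast
  qed
  then show ?thesis unfolding square_free_def by blast
qed

lemma prefix_iff_take: "prefix u v \<longleftrightarrow> take (length u) v = u"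
  by (metis append_eq_conv_conj prefix_def take_is_prefix)

lemma square_free_sublist: "square_free w \<Longrightarrow> sublist v w \<Longrightarrow> square_free v"
  unfolding square_free_def by (meson sublist_order.order.trans)

lemma square_free_nth_Suc_neq: "square_free w \<Longrightarrow> Suc i < length w \<Longrightarrow> w ! i \<noteq> w ! Suc i"
  unfolding square_free_iff_nth by (rule notI, erule notE, intro exI[of _ i] exI[of _ 1]) simp

lemma square_free_map:
  assumes "square_free w" "inj f"
  shows "square_free (map f w)"
  unfolding square_free_iff_nth
proof
  assume "\<exists>i q. 0 < q \<and> i + 2 * q \<le> length (map f w) \<and>
    (\<forall>r<q. map f w ! (i + r) = map f w ! (i + q + r))"
  then obtain i q where q: "0 < q" "i + 2 * q \<le> length w"
    and eq: "\<And>r. r < q \<Longrightarrow> map f w ! (i + r) = map f w ! (i + q + r)" by auto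
  have "w ! (i + r) = w ! (i + q + r)" if "r < q" for r
    using eq[OF that] that q injD[OF assms(2)] by simp
  then show False using assms(1) q unfolding square_free_iff_nth by blast
qed

text \<open>
  A criterion for square-free morphisms: \<open>m\<close> marks the beginnings of the blocks, so
  that the two halves of a long square are cut into blocks in the same way, and by the
  last hypothesis the block in the middle of the square has the same letter as
  the block at the right end or at the left end of the square.
\<close>
locale marked_blocks =
  fixes g :: "'l \<Rightarrow> 'a list" and m :: "'a list"
  assumes marker: "m \<noteq> []" "prefix m (g x)"
    and marker_occurrence: "g x @ m = p @ m @ s \<Longrightarrow> p = [] \<or> s = []"
    and square_free_block: "square_free (g x @ m)"
    and square_free_pair: "x \<noteq> y \<Longrightarrow> square_free (g x @ g y @ m)"
    and cut: "g x = p @ s \<Longrightarrow> prefix p (g y) \<Longrightarrow> suffix s (g z) \<Longrightarrow> x = y \<or> x = z"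
begin

text \<open>The instance of \<open>cut\<close> with an empty second part: the blocks form a prefix
  code.\<close>

lemma prefix_code: "prefix (g x) (g y) \<Longrightarrow> x = y"
  using cut[of x "g x" "[]" y y] by simp

lemma length_marker: "0 < length m" "length m \<le> length (g x)"
  using marker prefix_length_le by auto

definition pos :: "'l list \<Rightarrow> nat \<Rightarrow> nat" where
  "pos cs k = length (concat (map g (take k cs)))"

context
  fixes cs :: "'l list" and T :: "'a list"
  defines "T \<equiv> concat (map g cs) @ m"
begin

lemma pos_0: "pos cs 0 = 0"
  by (simp add: pos_def)

lemma pos_length: "pos cs (length cs) + length m = length T"
  by (simp add: pos_def T_def)

lemma pos_Suc: "k < length cs \<Longrightarrow> pos cs (Suc k) = pos cs k + length (g (cs ! k))"
  by (simp add: pos_def take_Suc_conv_app_nth)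

lemma pos_mono: "j \<le> k \<Longrightarrow> k \<le> length cs \<Longrightarrow> pos cs j \<le> pos cs k"
proof (induction k rule: dec_induct)
  case (step k) then show ?case by (simp add: pos_Suc)
qed simp

lemma drop_pos:
  assumes "k < length cs"
  shows "drop (pos cs k) T = g (cs ! k) @ drop (pos cs (Suc k)) T"
proof -
  have *: "drop (pos cs k) T = concat (map g (drop k cs)) @ m" for k
  proof -
    have "T = concat (map g (take k cs)) @ concat (map g (drop k cs)) @ m"
      unfolding T_def by (metis append_assoc append_take_drop_id concat_append map_append)
    then show ?thesis by (simp add: pos_def)
  qed
  show ?thesis unfolding * using assms by (simp add: Cons_nth_drop_Suc[symmetric])
qed

lemma drop_pos_length: "drop (pos cs (length cs)) T = m"
  by (simp add: pos_def T_def)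

lemma marker_at_pos: "k \<le> length cs \<Longrightarrow> prefix m (drop (pos cs k) T)"
  using drop_pos[of k] drop_pos_length marker(2)[of "cs ! k"]
  by (cases "k = length cs") (auto intro: prefix_prefix)

lemma pos_bracket:
  assumes "j < pos cs (length cs)"
  obtains k where "k < length cs" "pos cs k \<le> j" "j < pos cs (Suc k)"
proof -
  define k where "k = (LEAST k. j < pos cs k)"
  have k: "j < pos cs k" unfolding k_def using assms by (rule LeastI)
  have "k \<le> length cs" unfolding k_def using assms by (rule Least_le)
  moreover have "k \<noteq> 0" using k pos_0 by (intro notI) simp
  moreover have "pos cs (k - 1) \<le> j"
    using not_less_Least[of "k - 1" "\<lambda>k. j < pos cs k"] \<open>k \<noteq> 0\<close> unfolding k_def by simp
  ultimately show ?thesis using k that[of "k - 1"] by simp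
qed

text \<open>An occurrence that starts in a block lies in that block followed by the next marker and
  ends before this marker does, so \<open>marker_occurrence\<close> puts it at the start of the
  block. The \<open>m\<close> at the end of \<open>T\<close> provides the next marker for the last
  block.\<close>

lemma marker_only_at_pos:
  assumes "j \<le> pos cs (length cs)" "prefix m (drop j T)"
  shows "\<exists>k\<le>length cs. j = pos cs k"
proof (cases "j = pos cs (length cs)")
  case False
  then have "j < pos cs (length cs)" using assms by simp
  then obtain k where k: "k < length cs" "pos cs k \<le> j" "j < pos cs (Suc k)"
    by (rule pos_bracket)
  let ?x = "cs ! k" and ?d = "j - pos cs k"
  have d: "?d < length (g ?x)" using k pos_Suc by simp
  obtain t where t: "drop (pos cs (Suc k)) T = m @ t"
    using marker_at_pos[of "Suc k"] k by (auto simp: prefix_def)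
  have "drop j T = drop ?d (drop (pos cs k) T)" using k by simp
  also have "\<dots> = drop ?d (g ?x) @ m @ t"
    using drop_pos[OF k(1)] t d by simp
  finally have "prefix m ((drop ?d (g ?x) @ m) @ t)" using assms(2) by simp
  then have "prefix m (drop ?d (g ?x) @ m)"
    by (rule prefix_length_prefix) auto
  then obtain s where s: "drop ?d (g ?x) @ m = m @ s" by (auto simp: prefix_def)
  then have "g ?x @ m = take ?d (g ?x) @ m @ s"
    by (metis append_assoc append_take_drop_id)
  then have "take ?d (g ?x) = [] \<or> s = []" by (rule marker_occurrence)
  moreover have "s \<noteq> []"
  proof
    assume "s = []"
    then have "length (drop ?d (g ?x)) = 0" using arg_cong[OF s, of length] by simp
    then show False using d by simp
  qed
  ultimately have "?d = 0" using d by auto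
  then show ?thesis using k by (intro exI[of _ k]) simp
qed auto

lemma segment_not_square:
  assumes "square_free v" "k \<le> length cs" "prefix v (drop (pos cs k) T)"
    and "pos cs k \<le> i" "i + 2 * q \<le> pos cs k + length v" "0 < q"
    and eq: "\<And>r. r < q \<Longrightarrow> T ! (i + r) = T ! (i + q + r)"
  shows False
proof -
  obtain t where t: "drop (pos cs k) T = v @ t" using assms by (auto simp: prefix_def)
  have le: "pos cs k \<le> length T" using pos_mono[OF assms(2)] pos_length by simp
  have nth: "v ! (a - pos cs k) = T ! a" if "pos cs k \<le> a" "a < pos cs k + length v" for a
  proof -
    have "v ! (a - pos cs k) = drop (pos cs k) T ! (a - pos cs k)"
      using that unfolding t by (simp add: nth_append less_diff_conv2)
    then show ?thesis using that le by simp
  qed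
  let ?i = "i - pos cs k"
  have "v ! (?i + r) = v ! (?i + q + r)" if "r < q" for r
    using nth[of "i + r"] nth[of "i + q + r"] eq[OF that] assms that by simp
  moreover have "?i + 2 * q \<le> length v" using assms by simp
  ultimately show False using assms(1,6) unfolding square_free_iff_nth by blast
qed

lemma not_square:
  assumes sf: "square_free cs"
    and q: "0 < q" and le: "i + 2 * q \<le> pos cs (length cs)"
    and eq: "\<And>r. r < q \<Longrightarrow> T ! (i + r) = T ! (i + q + r)"
  shows False
proof -
  let ?N = "length cs"
  have lenT: "pos cs ?N \<le> length T" using pos_length by simp
  have seg: "take h (drop a T) = take h (drop (a + q) T)" if "i \<le> a" "a + h \<le> i + q" for a h
  proof (rule nth_equalityI)
    show "length (take h (drop a T)) = length (take h (drop (a + q) T))"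
      using that le lenT by simp
    fix j assume "j < length (take h (drop a T))"
    then show "take h (drop a T) ! j = take h (drop (a + q) T) ! j"
      using that le lenT eq[of "a + j - i"] by (simp add: algebra_simps)
  qed
  \<comment> \<open>The first block boundaries at or after the beginning and the middle of the
    square.\<close>
  define k0 where "k0 = (LEAST k. i \<le> pos cs k)"
  define k1 where "k1 = (LEAST k. i + q \<le> pos cs k)"
  have k0: "i \<le> pos cs k0" "k0 \<le> ?N" "\<And>k. k < k0 \<Longrightarrow> pos cs k < i"
  proof -
    have "i \<le> pos cs ?N" using le by simp
    then show "i \<le> pos cs k0" "k0 \<le> ?N" unfolding k0_def by (rule LeastI, rule Least_le)
    show "pos cs k < i" if "k < k0" for k using not_less_Least[OF that[unfolded k0_def]] by simp
  qed
  have k1: "i + q \<le> pos cs k1" "k1 \<le> ?N" "\<And>k. k < k1 \<Longrightarrow> pos cs k < i + q"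
  proof -
    have "i + q \<le> pos cs ?N" using le by simp
    then show "i + q \<le> pos cs k1" "k1 \<le> ?N" unfolding k1_def by (rule LeastI, rule Least_le)
    show "pos cs k < i + q" if "k < k1" for k using not_less_Least[OF that[unfolded k1_def]] by simp
  qed
  have shift: "prefix m (drop (a + q) T) = prefix m (drop a T)"
    if "i \<le> a" "a + length m \<le> i + q" for a
    by (simp only: prefix_iff_take seg[OF that])
  show False
  proof (cases "pos cs k0 + length m \<le> i + q \<or> pos cs k1 + length m \<le> i + 2 * q")
    \<comment> \<open>Neither boundary is followed by a whole marker within its half, so the square
      is confined to at most two consecutive blocks and the next marker.\<close>
    case False
    then have k0': "i + q < pos cs k0 + length m" and k1': "i + 2 * q < pos cs k1 + length m"
      by auto
    have last: "i + 2 * q < pos cs (Suc k0) + length m" if "k0 < ?N"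
    proof -
      have "i + q \<le> pos cs (Suc k0)"
        using k0' pos_Suc[OF that] length_marker(2)[of "cs ! k0"] by simp
      then have "k1 \<le> Suc k0" unfolding k1_def by (rule Least_le)
      then show ?thesis using k1' pos_mono[of k1 "Suc k0"] that by simp
    qed
    have block: "prefix (g (cs ! k) @ m) (drop (pos cs k) T)" if "k < ?N" for k
      unfolding drop_pos[OF that] using marker_at_pos[of "Suc k"] that by simp
    have len: "pos cs k + length (g (cs ! k) @ m) = pos cs (Suc k) + length m" if "k < ?N" for k
      using pos_Suc[OF that] by simp
    show False
    proof (cases k0)
      case 0
      show False
      proof (cases "?N = 0")
        case True then show False using le q pos_0 by simp
      next
        case N: False
        then show False
          using segment_not_square[of "g (cs ! 0) @ m" 0 i q] square_free_block block[of 0] len[of 0]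
            last 0 q eq pos_0 by simp
      qed
    next
      case (Suc k)
      have ki: "pos cs k < i" using k0(3) Suc by simp
      show False
      proof (cases "k0 = ?N")
        case True
        then show False
          using segment_not_square[of "g (cs ! k) @ m" k i q] square_free_block block[of k] len[of k]
            q eq ki Suc le by simp
      next
        case N: False
        have "cs ! k \<noteq> cs ! k0" using square_free_nth_Suc_neq[OF sf, of k] Suc N k0(2) by simp
        then have "square_free (g (cs ! k) @ g (cs ! k0) @ m)" by (rule square_free_pair)
        moreover have "prefix (g (cs ! k) @ g (cs ! k0) @ m) (drop (pos cs k) T)"
          using drop_pos[of k] block[of k0] Suc N k0(2) by simp
        ultimately show False
          using segment_not_square[of "g (cs ! k) @ g (cs ! k0) @ m" k i q] len[of k0] pos_Suc[of k]
            q eq ki Suc N k0(2) last by simp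
      qed
    qed
  next
    case True
    \<comment> \<open>A marker inside one half recurs at distance \<open>q\<close> in the other, and
      markers start only at boundaries. Each of the two inequalities supplies the premise of the
      other, so a marker in one half is enough.\<close>
    have sync: "pos cs k0 + q = pos cs k1"
    proof -
      have a: "pos cs k1 \<le> pos cs k0 + q" if "pos cs k0 + length m \<le> i + q"
      proof -
        have "prefix m (drop (pos cs k0 + q) T)"
          using shift[of "pos cs k0"] marker_at_pos[of k0] k0 that by simp
        moreover have "pos cs k0 + q \<le> pos cs ?N" using that le by simp
        ultimately obtain k where k: "k \<le> ?N" "pos cs k0 + q = pos cs k"
          using marker_only_at_pos by blast
        then have "k1 \<le> k" unfolding k1_def using k0 by (intro Least_le) simp
        then show ?thesis using pos_mono[of k1 k] k by simp
      qed
      have b: "pos cs k0 + q \<le> pos cs k1" if "pos cs k1 + length m \<le> i + 2 * q"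
      proof -
        have "prefix m (drop (pos cs k1 - q) T)"
          using shift[of "pos cs k1 - q"] marker_at_pos[of k1] k1 that by simp
        moreover have "pos cs k1 - q \<le> pos cs ?N" using that le by simp
        ultimately obtain k where k: "k \<le> ?N" "pos cs k1 - q = pos cs k"
          using marker_only_at_pos by blast
        then have "k0 \<le> k" unfolding k0_def using k1 by (intro Least_le) simp
        then show ?thesis using pos_mono[of k0 k] k k1 by simp
      qed
      show ?thesis using a b True by linarith
    qed
    have "k0 < k1"
      using sync q pos_mono[of k1 k0] k0(2) by linarith
    define d where "d = k1 - k0"
    have d: "0 < d" "k1 = k0 + d" using \<open>k0 < k1\<close> unfolding d_def by auto
    \<comment> \<open>Blocks that lie entirely in the first half repeat in the second, and the
      prefix code recovers their letters. The last block that starts in the first half may reach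
      beyond the middle, hence the strict \<open>t' < t\<close>.\<close>
    have agree: "k1 + t < ?N \<and> pos cs (k0 + t) + q = pos cs (k1 + t) \<and>
        (\<forall>t'<t. cs ! (k0 + t') = cs ! (k1 + t'))" if "t < d" for t
      using that
    proof (induction t)
      case 0
      have "pos cs k0 < i + q" using k1(3)[of k0] \<open>k0 < k1\<close> by simp
      then have "k1 \<noteq> ?N" using sync le by auto
      then show ?case using sync k1(2) by simp
    next
      case (Suc t)
      then have IH: "k1 + t < ?N" "pos cs (k0 + t) + q = pos cs (k1 + t)"
          "\<forall>t'<t. cs ! (k0 + t') = cs ! (k1 + t')"
        by auto
      let ?x = "cs ! (k0 + t)" and ?y = "cs ! (k1 + t)"
      have x_end: "pos cs (Suc (k0 + t)) < i + q" using k1(3)[of "Suc (k0 + t)"] Suc.prems d by simp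
      have k0t: "k0 + t < ?N" using IH \<open>k0 < k1\<close> by simp
      have "i \<le> pos cs (k0 + t)" using k0(1) pos_mono[of k0 "k0 + t"] k0t by simp
      then have "take (length (g ?x)) (drop (pos cs (k0 + t)) T) =
          take (length (g ?x)) (drop (pos cs (k1 + t)) T)"
        using seg[of "pos cs (k0 + t)" "length (g ?x)"] x_end pos_Suc[OF k0t] IH by simp
      then have "prefix (g ?x) (drop (pos cs (k1 + t)) T)"
        unfolding drop_pos[OF k0t] by (metis append_eq_conv_conj take_is_prefix)
      moreover have "prefix (g ?y) (drop (pos cs (k1 + t)) T)"
        unfolding drop_pos[OF IH(1)] by simp
      ultimately have "prefix (g ?x) (g ?y) \<or> prefix (g ?y) (g ?x)" by (rule prefix_same_cases)
      then have xy: "?x = ?y" using prefix_code by metis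
      then have pos': "pos cs (k0 + Suc t) + q = pos cs (k1 + Suc t)"
        using pos_Suc[OF k0t] pos_Suc[OF IH(1)] IH by simp
      moreover have "k1 + Suc t \<noteq> ?N" using pos' x_end le by auto
      ultimately show ?case using IH xy by (auto simp: less_Suc_eq)
    qed
    \<comment> \<open>\<open>M\<close> is the block that reaches the middle, \<open>R\<close> its
      counterpart at the right end, and \<open>k0 - 1\<close> the block at the left end. If
      \<open>M\<close> had the letter of \<open>R\<close> or of \<open>k0 - 1\<close>, then
      \<open>cs\<close> would contain a square of period \<open>d\<close>, starting at
      \<open>k0\<close> or at \<open>k0 - 1\<close>.\<close>
    define M where "M = k1 - 1"
    define R where "R = k1 + (d - 1)"
    have MR: "M = k0 + (d - 1)" "M < ?N" "R < ?N" "Suc M = k1" "pos cs M + q = pos cs R"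
      using agree[of "d - 1"] d k1(2) unfolding M_def R_def by auto
    have M_start: "pos cs M < i + q" using k1(3)[of M] MR by simp
    have k0_M: "pos cs k0 \<le> pos cs M" using pos_mono[of k0 M] MR(1,2) by simp
    then have M_ge: "i \<le> pos cs M" using k0(1) by simp
    have right_neq: "cs ! M \<noteq> cs ! R"
    proof
      assume "cs ! M = cs ! R"
      then have "cs ! (k0 + t) = cs ! (k0 + d + t)" if "t < d" for t
        using agree[of "d - 1"] that d MR R_def
        by (cases "t = d - 1") (auto simp: add.assoc)
      moreover have "k0 + 2 * d \<le> ?N" using MR d R_def by simp
      ultimately show False using sf d unfolding square_free_iff_nth by blast
    qed
    \<comment> \<open>The middle of the square cuts block \<open>M\<close> into \<open>?p\<close>
      and \<open>?s\<close>: \<open>?p\<close> begins block \<open>R\<close>, and \<open>?s\<close>,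
      if nonempty, ends block \<open>k0 - 1\<close>. This is the situation of
      \<open>cut\<close>.\<close>
    define h where "h = i + q - pos cs M"
    have h: "h \<le> length (g (cs ! M))"
      using k1(1) pos_Suc[OF MR(2)] unfolding MR(4) h_def by linarith
    let ?p = "take h (g (cs ! M))" and ?s = "drop h (g (cs ! M))"
    have "take h (drop (pos cs M) T) = take h (drop (pos cs R) T)"
      using seg[of "pos cs M" h] MR M_ge M_start unfolding h_def by simp
    then have "prefix ?p (drop (pos cs R) T)"
      unfolding drop_pos[OF MR(2)] using h by (metis append_take_drop_id take_is_prefix
          diff_is_0_eq' take_append take_eq_Nil append_Nil2)
    moreover have "prefix (g (cs ! R)) (drop (pos cs R) T)"
      unfolding drop_pos[OF MR(3)] by simp
    ultimately have "prefix ?p (g (cs ! R)) \<or> prefix (g (cs ! R)) ?p"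
      by (rule prefix_same_cases)
    then have p: "prefix ?p (g (cs ! R))"
    proof
      assume "prefix (g (cs ! R)) ?p"
      then have "prefix (g (cs ! R)) (g (cs ! M))" using take_is_prefix prefix_order.trans by blast
      then have "cs ! R = cs ! M" by (rule prefix_code)
      then show ?thesis using take_is_prefix by metis
    qed
    have len: "length ?s = pos cs k0 - i"
      using sync pos_Suc[OF MR(2)] M_start unfolding MR(4) h_def length_drop by linarith
    have left_neq: "cs ! M \<noteq> cs ! (k0 - 1)" if "?s \<noteq> []"
    proof
      have "pos cs k0 > i" using len that by auto
      then have "k0 \<noteq> 0" using pos_0 by (intro notI) simp
      assume LM: "cs ! M = cs ! (k0 - 1)"
      have "cs ! (k0 - 1 + t) = cs ! (k0 - 1 + d + t)" if "t < d" for t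
      proof (cases t)
        case 0
        then show ?thesis using LM MR d \<open>k0 \<noteq> 0\<close> by (simp add: M_def)
      next
        case (Suc t')
        then have "t' < d - 1" using that by simp
        then have "cs ! (k0 + t') = cs ! (k1 + t')" using agree[of "d - 1"] d by simp
        then show ?thesis using Suc \<open>k0 \<noteq> 0\<close> d by simp
      qed
      moreover have "k0 - 1 + 2 * d \<le> ?N" using MR d R_def by simp
      ultimately show False using sf d unfolding square_free_iff_nth by blast
    qed
    have L: "suffix ?s (g (cs ! (k0 - 1)))" if "?s \<noteq> []"
    proof -
      have i: "pos cs k0 > i" using len that by auto
      then have "k0 \<noteq> 0" using pos_0 by (intro notI) simp
      let ?L = "k0 - 1"
      have L: "?L < ?N" "Suc ?L = k0" "pos cs ?L < i" using k0 \<open>k0 \<noteq> 0\<close> by auto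
      have "take (pos cs k0 - i) (drop i T) = take (pos cs k0 - i) (drop (i + q) T)"
        using seg[of i "pos cs k0 - i"] M_start k0_M by simp
      moreover have "drop (i + q) T = ?s @ drop (pos cs (Suc M)) T"
      proof -
        have "drop (i + q) T = drop h (drop (pos cs M) T)" using M_start by (simp add: h_def)
        then show ?thesis unfolding drop_pos[OF MR(2)] using h by simp
      qed
      moreover have "drop i T = drop (i - pos cs ?L) (g (cs ! ?L)) @ drop (pos cs k0) T"
      proof -
        have "drop i T = drop (i - pos cs ?L) (drop (pos cs ?L) T)" using L by simp
        then show ?thesis unfolding drop_pos[OF L(1)] L(2) using pos_Suc[OF L(1)] i L by simp
      qed
      moreover have "length (drop (i - pos cs ?L) (g (cs ! ?L))) = pos cs k0 - i"
        using pos_Suc[OF L(1)] L(3) unfolding L(2) length_drop by linarith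
      ultimately have "?s = drop (i - pos cs ?L) (g (cs ! ?L))" using len by (metis append_eq_conv_conj)
      then show ?thesis by (simp add: suffix_drop)
    qed
    show False
    proof (cases "?s = []")
      \<comment> \<open>There may be no block \<open>k0 - 1\<close> here, so \<open>R\<close> is
        used on both sides.\<close>
      case True
      then show False
        using cut[of "cs ! M" ?p ?s "cs ! R" "cs ! R"] p right_neq by simp
    next
      case False
      then show False
        using cut[of "cs ! M" ?p ?s "cs ! R" "cs ! (k0 - 1)"] p right_neq left_neq L by simp
    qed
  qed
qed

end

theorem square_free_concat:
  assumes "square_free cs"
  shows "square_free (concat (map g cs))"
proof (rule ccontr)
  let ?w = "concat (map g cs)"
  assume "\<not> square_free ?w"
  then obtain i q where q: "0 < q" "i + 2 * q \<le> length ?w"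
    and eq: "\<And>r. r < q \<Longrightarrow> ?w ! (i + r) = ?w ! (i + q + r)"
    unfolding square_free_iff_nth by blast
  have "(?w @ m) ! (i + r) = (?w @ m) ! (i + q + r)" if "r < q" for r
    using eq[OF that] that q by (simp add: nth_append)
  then show False
    using not_square[OF assms q(1), of i] q(2) by (simp add: pos_def)
qed

end

section \<open>Deciding square-freeness\<close>

text \<open>Matching on the constructors of \<open>letter\<close> compares two letters in one
  rewrite step, without evaluating an equality.\<close>

fun agree :: "nat \<Rightarrow> letter list \<Rightarrow> letter list \<Rightarrow> bool" where
  "agree 0 xs ys = True"
| "agree (Suc p) (La # xs) (La # ys) = agree p xs ys"
| "agree (Suc p) (Lb # xs) (Lb # ys) = agree p xs ys"
| "agree (Suc p) (Lc # xs) (Lc # ys) = agree p xs ys"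
| "agree (Suc p) xs ys = False"

text \<open>
  Scans two words in parallel for \<open>p\<close> consecutive positions with equal letters; \<open>r\<close> is
  the number of matches that are still missing in the current run. (Nested conditionals replace
  conjunctions here and below because the evaluation by rewriting is strict in both conjuncts.)
\<close>
fun run :: "nat \<Rightarrow> nat \<Rightarrow> letter list \<Rightarrow> letter list \<Rightarrow> bool" where
  "run 0 p xs ys = True"
| "run (Suc r) p (La # xs) (La # ys) = run r p xs ys"
| "run (Suc r) p (Lb # xs) (Lb # ys) = run r p xs ys"
| "run (Suc r) p (Lc # xs) (Lc # ys) = run r p xs ys"
| "run (Suc r) p (x # xs) (y # ys) = run p p xs ys"
| "run (Suc r) p xs ys = False"

text \<open>Tries \<open>k\<close> periods from \<open>p\<close> on. \<open>ys\<close> is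
  \<open>xs\<close> without its first \<open>p\<close> letters, so a square of period
  \<open>p\<close> is a run of \<open>p\<close> matches between the two.\<close>

fun has_square_from :: "nat \<Rightarrow> nat \<Rightarrow> letter list \<Rightarrow> letter list \<Rightarrow> bool" where
  "has_square_from 0 p xs ys = False"
| "has_square_from (Suc k) p xs [] = False"
| "has_square_from (Suc k) p xs (y # ys) =
    (if run p p xs (y # ys) then True else has_square_from k (Suc p) xs ys)"

definition has_square :: "nat \<Rightarrow> letter list \<Rightarrow> bool" where
  "has_square k w = has_square_from k (Suc 0) w (tl w)"

text \<open>A structural replacement for division by two, suited to evaluation by rewriting.\<close>

fun half_length :: "'a list \<Rightarrow> nat" where
  "half_length (x # y # xs) = Suc (half_length xs)"
| "half_length xs = 0"

definition contains_square :: "letter list \<Rightarrow> bool" where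
  "contains_square w = has_square (half_length w) w"

definition circular_square :: "letter list \<Rightarrow> bool" where
  "circular_square w = has_square (half_length w) (w @ w)"

lemma half_length: "half_length w = length w div 2"
  by (induction w rule: half_length.induct) auto

lemma agree_iff: "agree p xs ys \<longleftrightarrow> p \<le> length xs \<and> p \<le> length ys \<and> take p xs = take p ys"
  by (induction p xs ys rule: agree.induct) auto

lemma run_Suc_Cons:
  "run (Suc r) p (x # xs) (y # ys) = (if x = y then run r p xs ys else run p p xs ys)"
  by (cases x; cases y) auto

lemma run_Suc_Nil: "run (Suc r) p [] ys = False" "run (Suc r) p xs [] = False"
  by (cases ys rule: list.exhaust; cases "hd ys"; auto) (cases xs rule: list.exhaust; cases "hd xs"; auto)

text \<open>Either the current run is completed at once, or a full run of length \<open>p\<close>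
  starts at some offset. By \<open>r \<le> p\<close>, a full run at the present position also
  completes the current one.\<close>

lemma run_iff:
  "r \<le> p \<Longrightarrow> run r p xs ys \<longleftrightarrow> agree r xs ys \<or> (\<exists>i. agree p (drop i xs) (drop i ys))"
proof (induction xs arbitrary: r ys)
  case Nil
  then show ?case by (cases r) (auto simp: run_Suc_Nil agree_iff)
next
  case (Cons x xs)
  show ?case
  proof (cases "r = 0 \<or> ys = []")
    case True
    then show ?thesis using Cons.prems by (cases r) (auto simp: run_Suc_Nil agree_iff)
  next
    case False
    then obtain r' y ys' p' where *: "r = Suc r'" "ys = y # ys'" "p = Suc p'" "r' \<le> p'"
      using Cons.prems by (cases r; cases ys; cases p) auto
    have "(\<exists>i. agree p (drop i (x # xs)) (drop i ys)) \<longleftrightarrow>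
        agree p (x # xs) ys \<or> (\<exists>i. agree p (drop i xs) (drop i ys'))"
      unfolding *(2) by (metis drop0 drop_Suc_Cons not0_implies_Suc)
    moreover have "agree p (x # xs) ys \<longleftrightarrow> x = y \<and> agree p' xs ys'"
      "agree r (x # xs) ys \<longleftrightarrow> x = y \<and> agree r' xs ys'"
      unfolding * agree_iff by auto
    moreover have "agree p' xs ys' \<Longrightarrow> agree r' xs ys'"
      using *(4) unfolding agree_iff by (auto dest: arg_cong[where f = "take r'"] simp: min_absorb1)
    moreover have "agree p xs ys' \<Longrightarrow> \<exists>i. agree p (drop i xs) (drop i ys')" by (metis drop0)
    ultimately show ?thesis
      using Cons.IH[of r' ys'] Cons.IH[of p ys'] * by (auto simp: run_Suc_Cons)
  qed
qed

lemma has_square_from_iff: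
  "has_square_from k p w (drop p w) \<longleftrightarrow>
     (\<exists>q i. p \<le> q \<and> q < p + k \<and> q < length w \<and> agree q (drop i w) (drop i (drop q w)))"
proof (induction k arbitrary: p)
  case (Suc k)
  have split: "(\<exists>q. p \<le> q \<and> q < p + Suc k \<and> A q) \<longleftrightarrow> A p \<or> (\<exists>q. Suc p \<le> q \<and> q < Suc p + k \<and> A q)"
    for p k :: nat and A
  proof -
    have "p \<le> q \<and> q < p + Suc k \<longleftrightarrow> q = p \<or> Suc p \<le> q \<and> q < Suc p + k" for q by arith
    then show ?thesis by metis
  qed
  show ?case
  proof (cases "drop p w")
    case Nil
    then show ?thesis by auto
  next
    case (Cons y ys)
    have ys: "ys = drop (Suc p) w" using Cons by (metis drop_Suc list.sel(3) tl_drop)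
    have "has_square_from (Suc k) p w (drop p w) \<longleftrightarrow>
        run p p w (drop p w) \<or> has_square_from k (Suc p) w (drop (Suc p) w)"
      unfolding Cons ys[symmetric] by simp
    also have "run p p w (drop p w) \<longleftrightarrow> (\<exists>i. agree p (drop i w) (drop i (drop p w)))"
      unfolding run_iff[OF order_refl] by (metis drop0)
    also have "p < length w" using Cons by (metis drop_eq_Nil list.distinct(1) not_le)
    ultimately show ?thesis unfolding Suc.IH
      using split[of p k "\<lambda>q. q < length w \<and> (\<exists>i. agree q (drop i w) (drop i (drop q w)))"]
      by auto
  qed
qed auto

lemma has_square_iff:
  "has_square k w \<longleftrightarrow> (\<exists>u. u \<noteq> [] \<and> length u \<le> k \<and> sublist (u @ u) w)"
proof
  assume "has_square k w"
  then obtain q i where q: "1 \<le> q" "q \<le> k" "agree q (drop i w) (drop i (drop q w))"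
    using has_square_from_iff[of k "Suc 0" w] unfolding has_square_def drop_Suc drop0 by auto
  let ?u = "take q (drop i w)"
  have "take q (drop i (drop q w)) = ?u" "length ?u = q" using q(3) unfolding agree_iff by auto
  moreover have "drop i (drop q w) = drop q (drop i w)" by (simp add: add.commute)
  ultimately have "w = take i w @ (?u @ ?u) @ drop q (drop q (drop i w))" 
    by (metis append.assoc append_take_drop_id)
  then have "sublist (?u @ ?u) w" by (metis sublist_appendI)
  then show "\<exists>u. u \<noteq> [] \<and> length u \<le> k \<and> sublist (u @ u) w"
    using q \<open>length ?u = q\<close> by (intro exI[of _ ?u]) auto
next
  assume "\<exists>u. u \<noteq> [] \<and> length u \<le> k \<and> sublist (u @ u) w"
  then obtain u x s where u: "u \<noteq> []" "length u \<le> k" "w = x @ u @ u @ s" by (auto simp: sublist_def)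
  have "agree (length u) (drop (length x) w) (drop (length x) (drop (length u) w))"
    unfolding agree_iff u(3) by (simp add: add.commute[of "length u"])
  moreover have "1 \<le> length u" using u(1) by (cases u) auto
  moreover have "length u < length w" using u(1) unfolding u(3) by simp
  ultimately have "\<exists>q i. Suc 0 \<le> q \<and> q < Suc 0 + k \<and> q < length w \<and>
      agree q (drop i w) (drop i (drop q w))"
    using u(2) by (intro exI[of _ "length u"] exI[of _ "length x"]) simp
  then show "has_square k w"
    unfolding has_square_from_iff[symmetric] has_square_def by (simp add: drop_Suc)
qed

lemma contains_square_iff: "contains_square w \<longleftrightarrow> \<not> square_free w"
proof -
  have "length u \<le> half_length w" if "sublist (u @ u) w" for u
    using sublist_length_le[OF that] by (simp add: half_length)
  then show ?thesis unfolding contains_square_def square_free_def has_square_iff by blast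
qed

section \<open>Circular words and their extensions\<close>

lemma circular_word_sym: "v \<in> circular_word w \<Longrightarrow> circular_word v = circular_word w"
proof -
  have sub: "circular_word v \<subseteq> circular_word w" if vw: "v \<in> circular_word w" for v w :: "'a list"
  proof
    obtain x y where xy: "w = x @ y" "v = y @ x" using vw by (auto simp: circular_word_def conjugate_def)
    fix u assume "u \<in> circular_word v"
    then obtain s t where "y @ x = s @ t" "u = t @ s"
      using xy by (auto simp: circular_word_def conjugate_def)
    then show "u \<in> circular_word w" unfolding xy circular_word_def conjugate_def
      by (auto simp: append_eq_append_conv2)
  qed
  assume "v \<in> circular_word w"
  moreover have "w \<in> circular_word v"
    using \<open>v \<in> circular_word w\<close> by (auto simp: circular_word_def conjugate_def)
  ultimately show ?thesis using sub by blast
qed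

lemma append_commute_circular_word: "y @ x \<in> circular_word (x @ y)"
  by (auto simp: circular_word_def conjugate_def)

lemma circular_word_append_commute: "circular_word (y @ x) = circular_word (x @ y)"
  by (rule circular_word_sym[OF append_commute_circular_word])

lemma self_in_circular_word: "w \<in> circular_word w"
  using append_commute_circular_word[of w "[]"] by simp

lemma length_circular_word: "v \<in> circular_word w \<Longrightarrow> length v = length w"
  by (auto simp: circular_word_def conjugate_def)

text \<open>The conjugates are factors of \<open>w @ w\<close>. Conversely, a square no longer than
  \<open>w\<close> starts in the first copy, and then lies in a conjugate, or it lies in the second
  copy.\<close>

lemma circular_square_free_iff:
  "circular_square_free (circular_word w) \<longleftrightarrow>
     \<not> (\<exists>u. u \<noteq> [] \<and> 2 * length u \<le> length w \<and> sublist (u @ u) (w @ w))"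
proof -
  have "(\<exists>v\<in>circular_word w. \<exists>u. u \<noteq> [] \<and> sublist (u @ u) v) \<longleftrightarrow>
      (\<exists>u. u \<noteq> [] \<and> 2 * length u \<le> length w \<and> sublist (u @ u) (w @ w))" (is "?L = ?R")
  proof
    assume ?L
    then obtain x y u where u: "w = x @ y" "u \<noteq> []" "sublist (u @ u) (y @ x)"
      by (auto simp: circular_word_def conjugate_def)
    moreover have "w @ w = x @ (y @ x) @ y" using u(1) by simp
    ultimately have "sublist (u @ u) (w @ w)"
      using sublist_order.order.trans[OF _ sublist_appendI] by metis
    moreover have "2 * length u \<le> length w" using sublist_length_le[OF u(3)] u(1) by simp
    ultimately show ?R using u by blast
  next
    assume ?R
    then obtain u p s where u: "u \<noteq> []" "2 * length u \<le> length w" "w @ w = p @ (u @ u) @ s"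
      by (auto simp: sublist_def)
    show ?L
    proof (cases "length p \<le> length w")
      case True
      have "take (length p) (w @ w) = p" by (simp add: u(3))
      then have "take (length p) w = p" using True by simp
      then obtain y where y: "w = p @ y" by (metis append_take_drop_id)
      then have "y @ p @ y = (u @ u) @ s" using u(3) by simp
      then have "prefix (u @ u) ((y @ p) @ y)" by (simp add: prefix_def)
      then have "prefix (u @ u) (y @ p)" by (rule prefix_length_prefix) (use u(2) y in simp_all)
      then have "sublist (u @ u) (y @ p)" by (rule prefix_imp_sublist)
      moreover have "y @ p \<in> circular_word w" unfolding y by (rule append_commute_circular_word)
      ultimately show ?thesis using u(1) by metis
    next
      case False
      obtain t where "w = p @ t \<and> t @ w = (u @ u) @ s \<or> w @ t = p \<and> w = t @ (u @ u) @ s"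
        using u(3) unfolding append_eq_append_conv2 by blast
      then have "w = t @ (u @ u) @ s" using False by auto
      then have "sublist (u @ u) w" unfolding sublist_def by blast
      then show ?thesis using u(1) self_in_circular_word by blast
    qed
  qed
  then show ?thesis unfolding circular_square_free_def square_free_def by blast
qed

lemma circular_square_iff: "circular_square w \<longleftrightarrow> \<not> circular_square_free (circular_word w)"
  unfolding circular_square_def has_square_iff circular_square_free_iff half_length
  by (auto simp: less_eq_div_iff_mult_less_eq mult.commute)

text \<open>Rotation moves the insertion place to the front, so it suffices to prepend a letter to
  every conjugate.\<close>

lemma extremal_square_free_iff:
  "extremal_square_free (circular_word w) \<longleftrightarrow> circular_square_free (circular_word w) \<and>
     (\<forall>v a. v \<in> circular_word w \<longrightarrow> \<not> circular_square_free (circular_word (a # v)))"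
proof -
  have "(\<forall>W'. extension (circular_word w) W' \<longrightarrow> \<not> circular_square_free W') \<longleftrightarrow>
      (\<forall>v a. v \<in> circular_word w \<longrightarrow> \<not> circular_square_free (circular_word (a # v)))" (is "?L = ?R")
  proof
    assume L: ?L
    show ?R
    proof (intro allI impI)
      fix v a assume "v \<in> circular_word w"
      then have "extension (circular_word w) (circular_word (a # v))"
        unfolding extension_def
        by (intro exI[of _ "[]"] exI[of _ v] exI[of _ a]) (simp add: circular_word_sym)
      then show "\<not> circular_square_free (circular_word (a # v))" using L by blast
    qed
  next
    assume R: ?R
    show ?L
    proof (intro allI impI)
      fix W' assume "extension (circular_word w) W'"
      then obtain x y a where xy: "circular_word w = circular_word (x @ y)"
          "W' = circular_word (x @ [a] @ y)"
        by (auto simp: extension_def)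
      have "y @ x \<in> circular_word w" unfolding xy(1) by (rule append_commute_circular_word)
      then have "\<not> circular_square_free (circular_word (a # y @ x))" using R by blast
      then show "\<not> circular_square_free W'"
        using circular_word_append_commute[of "a # y" x] unfolding xy(2) by simp
    qed
  qed
  then show ?thesis unfolding extremal_square_free_def by blast
qed

text \<open>Between different letters this is the only one whose insertion avoids a square of length
  two. The last equation is a default value.\<close>

fun third :: "letter \<Rightarrow> letter \<Rightarrow> letter" where
  "third La Lb = Lc" | "third Lb La = Lc"
| "third La Lc = Lb" | "third Lc La = Lb"
| "third Lb Lc = La" | "third Lc Lb = La"
| "third x y = x"

lemma third_cases: "a = x \<or> a = y \<or> a = third x y" if "x \<noteq> y"
  using that by (cases a; cases x; cases y) auto

section \<open>Lengths without extremal words\<close>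

text \<open>\<open>l\<close> holds the letters to the left of the insertion place in reverse order.
  Success means that the third letter can be inserted at some inner place; one such witness refutes
  extremality.\<close>

fun unkilled :: "letter list \<Rightarrow> letter list \<Rightarrow> bool" where
  "unkilled (x # l) (y # r) =
     (if circular_square (rev (x # l) @ third x y # y # r) then unkilled (y # x # l) r else True)"
| "unkilled l r = False"

text \<open>
  Here \<open>r\<close> is the reversal of \<open>w\<close>. The first test only looks at the \<open>j\<close> letters on either
  side of the seam, where most circular squares show up.
\<close>
definition not_extremal :: "nat \<Rightarrow> letter list \<Rightarrow> letter list \<Rightarrow> bool" where
  "not_extremal j r w \<longleftrightarrow>
     (if has_square j (rev (take j r) @ take j w) then True
      else if circular_square w then True else unkilled [hd w] (tl w))"

text \<open>\<open>ys\<close> is \<open>r\<close> without its first \<open>p\<close> letters. As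
  words are reversed, a square completed by the new letter \<open>x\<close> is a prefix of
  \<open>x # r\<close>; for period \<open>p + 1\<close> its second half starts at
  \<open>y\<close>.\<close>

fun hits :: "letter \<Rightarrow> nat \<Rightarrow> nat \<Rightarrow> letter list \<Rightarrow> letter list \<Rightarrow> bool" where
  "hits x (Suc k) p r (y # ys) =
     (if x = y then if agree p r ys then True else hits x k (Suc p) r ys
      else hits x k (Suc p) r ys)"
| "hits x k p r ys = False"

text \<open>
  Words are extended letter by letter and kept reversed, so that \<open>r\<close> begins with the newest
  letter. Only squares of period at most \<open>k\<close> are pruned; the list of booleans tells the
  lengths at which the words found have to be tested.
\<close>
fun search :: "nat \<Rightarrow> nat \<Rightarrow> (letter list \<Rightarrow> bool) \<Rightarrow> bool list \<Rightarrow> letter list \<Rightarrow> bool" where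
  "search j k P [] r = True"
| "search j k P (b # bs) r =
     (if (if b then not_extremal j r (rev r) else True) then
        if (if hits La k 0 r r then True else if P (La # r) then True else search j k P bs (La # r)) then
        if (if hits Lb k 0 r r then True else if P (Lb # r) then True else search j k P bs (Lb # r)) then
           (if hits Lc k 0 r r then True else if P (Lc # r) then True else search j k P bs (Lc # r))
        else False else False else False)"

text \<open>Read backwards, the word ends in xyzxzyz, a renaming of abcacbc: in a square-free word
  the three letters differ, since any two of them are adjacent somewhere.\<close>

fun ends_in_pattern :: "letter list \<Rightarrow> bool" where
  "ends_in_pattern (z # y # z' # x # z'' # y' # x' # w) =
     (if z = z' then if z = z'' then if y = y' then x = x' else False else False else False)"
| "ends_in_pattern w = False"

section \<open>Soundness of the search\<close>

lemma square_free_rev: "square_free (rev w) \<longleftrightarrow> square_free w"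
proof -
  have "square_free (rev w)" if sf: "square_free w" for w :: "'a list"
    unfolding square_free_def
  proof
    assume "\<exists>x. x \<noteq> [] \<and> sublist (x @ x) (rev w)"
    then obtain x where x: "x \<noteq> []" "sublist (x @ x) (rev w)" by blast
    then have "sublist (rev x @ rev x) w"
      using sublist_rev_right[of "x @ x" w] by simp
    then show False using sf x(1) unfolding square_free_def by (metis rev_is_Nil_conv)
  qed
  from this[of w] this[of "rev w"] show ?thesis by auto
qed

lemma hits_not_square_free:
  "hits x k p r (drop p r) \<Longrightarrow> \<not> square_free (x # r)"
proof (induction k arbitrary: p)
  case (Suc k)
  obtain y ys where ys: "drop p r = y # ys" using Suc.prems by (cases "drop p r") auto
  have dr: "ys = drop (Suc p) r" using ys by (metis drop_Suc list.sel(3) tl_drop)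
  show ?case
  proof (cases "x = y \<and> agree p r ys")
    case True
    then have eq: "take p r = take p ys" unfolding agree_iff by simp
    have "r = take p r @ x # take p r @ drop p ys"
      using True ys eq by (metis append_take_drop_id)
    then have "x # r = (x # take p r) @ (x # take p r) @ drop p ys" by simp
    then have "sublist ((x # take p r) @ (x # take p r)) (x # r)"
      by (metis append_Nil append_assoc sublist_appendI)
    then show ?thesis unfolding square_free_def by blast
  next
    case False
    then have "hits x k (Suc p) r ys" using Suc.prems unfolding ys by (auto split: if_splits)
    then show ?thesis using Suc.IH dr by simp
  qed
qed auto

lemma unkilled_extension:
  "unkilled l r \<Longrightarrow> \<exists>u v a. rev l @ r = u @ v \<and> \<not> circular_square (u @ a # v)"
proof (induction l r rule: unkilled.induct)
  case (1 x l y r)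
  show ?case
  proof (cases "circular_square (rev (x # l) @ third x y # y # r)")
    case True
    then show ?thesis using 1 by simp
  next
    case False
    then show ?thesis by (metis append_Cons append_assoc)
  qed
qed auto

text \<open>The window around the seam is a factor of \<open>w @ w\<close>, and
  \<open>2 * j \<le> length w\<close> makes every square of period at most \<open>j\<close> short
  enough to lie in a conjugate.\<close>

lemma not_extremal_sound:
  assumes "not_extremal j r w" "w = rev r" "w \<noteq> []" "2 * j \<le> length w"
  shows "\<not> extremal_square_free (circular_word w)"
proof -
  consider "has_square j (rev (take j r) @ take j w)" | "circular_square w" | "unkilled [hd w] (tl w)"
    using assms(1) unfolding not_extremal_def by (auto split: if_splits)
  then show ?thesis
  proof cases
    case 1
    then obtain u where u: "u \<noteq> []" "length u \<le> j" "sublist (u @ u) (rev (take j r) @ take j w)"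
      unfolding has_square_iff by blast
    have "w = rev (drop j r) @ rev (take j r)"
      unfolding assms(2) by (metis append_take_drop_id rev_append)
    then have "w @ w = rev (drop j r) @ (rev (take j r) @ take j w) @ drop j w"
      by (metis append_assoc append_take_drop_id)
    then have "sublist (u @ u) (w @ w)"
      using sublist_order.order.trans[OF u(3) sublist_appendI] by metis
    then have "\<not> circular_square_free (circular_word w)"
      using u(1,2) assms(4) unfolding circular_square_free_iff by (intro notI, elim notE, intro exI[of _ u]) simp
    then show ?thesis unfolding extremal_square_free_def by blast
  next
    case 2
    then show ?thesis unfolding circular_square_iff extremal_square_free_def by blast
  next
    case 3
    then obtain u v a where "rev [hd w] @ tl w = u @ v" and a: "\<not> circular_square (u @ a # v)"
      using unkilled_extension by metis
    then have "w = u @ v" using assms(3) by simp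
    then have "extension (circular_word w) (circular_word (u @ [a] @ v))"
      unfolding extension_def by blast
    then show ?thesis
      using a unfolding circular_square_iff extremal_square_free_def by auto
  qed
qed

text \<open>\<open>hits\<close> discards only words with a square, and \<open>P\<close> fails on all
  prefixes, so the branch that spells \<open>v\<close> is never cut off.\<close>

lemma search_sound:
  assumes "search j k P bs r" "length v < length bs" "bs ! length v" "square_free (rev r @ v)"
    and "\<And>u s. rev r @ v = rev u @ s \<Longrightarrow> \<not> P u"
  shows "not_extremal j (rev v @ r) (rev r @ v)"
  using assms
proof (induction bs arbitrary: r v)
  case (Cons b bs)
  show ?case
  proof (cases v)
    case Nil
    then show ?thesis using Cons.prems(1,3) by (auto split: if_splits)
  next
    case (Cons x v')
    have "square_free (rev (x # r))"
      by (rule square_free_sublist[OF Cons.prems(4)]) (simp add: Cons sublist_appendI prefix_imp_sublist)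
    then have "\<not> hits x k 0 r r"
      using hits_not_square_free[of x k 0 r] unfolding square_free_rev by auto
    moreover have "\<not> P (x # r)" using Cons.prems(5)[of "x # r" v'] Cons by simp
    ultimately have "search j k P bs (x # r)"
      using Cons.prems(1) by (cases x) (simp_all split: if_splits)
    then show ?thesis
      using Cons.IH[of "x # r" v'] Cons.prems Cons by simp
  qed
qed simp

section \<open>Renaming of letters\<close>

lemma circular_word_map: "circular_word (map f w) = map f ` circular_word w"
proof (rule set_eqI, rule iffI)
  fix v assume "v \<in> circular_word (map f w)"
  then obtain x y where "w = x @ y" "v = map f (y @ x)"
    by (auto simp: circular_word_def conjugate_def map_eq_append_conv)
  then show "v \<in> map f ` circular_word w" using append_commute_circular_word by blast
next
  fix v assume "v \<in> map f ` circular_word w"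
  then obtain x y where "w = x @ y" "v = map f y @ map f x"
    by (auto simp: circular_word_def conjugate_def)
  then show "v \<in> circular_word (map f w)" using append_commute_circular_word by auto
qed

lemma circular_square_free_map:
  assumes "inj f" "circular_square_free (circular_word w)"
  shows "circular_square_free (circular_word (map f w))"
  using assms square_free_map unfolding circular_square_free_def circular_word_map by blast

lemma circular_square_free_map_iff:
  assumes "bij f"
  shows "circular_square_free (circular_word (map f w)) \<longleftrightarrow> circular_square_free (circular_word w)"
proof
  have inv: "map (inv f) (map f w) = w"
    using assms by (simp add: bij_is_inj o_def inv_f_f map_idI)
  assume "circular_square_free (circular_word (map f w))"
  then show "circular_square_free (circular_word w)"
    using circular_square_free_map[OF bij_is_inj[OF bij_imp_bij_inv[OF assms]], of "map f w"]
    unfolding inv by blast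
qed (rule circular_square_free_map[OF bij_is_inj[OF assms]])

lemma extremal_square_free_map:
  assumes "bij f" "extremal_square_free (circular_word w)"
  shows "extremal_square_free (circular_word (map f w))"
  unfolding extremal_square_free_iff
proof (intro conjI allI impI)
  show "circular_square_free (circular_word (map f w))"
    using assms unfolding extremal_square_free_iff circular_square_free_map_iff[OF assms(1)] by blast
  fix v a assume "v \<in> circular_word (map f w)"
  then obtain v' where v': "v = map f v'" "v' \<in> circular_word w" unfolding circular_word_map by blast
  obtain a' where "a = f a'" using bij_is_surj[OF assms(1)] by (metis surjD)
  then have "a # v = map f (a' # v')" using v' by simp
  then show "\<not> circular_square_free (circular_word (a # v))"
    using assms v'(2) circular_square_free_map_iff[OF assms(1), of "a' # v'"]
    unfolding extremal_square_free_iff by simp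
qed

definition rename :: "letter \<Rightarrow> letter \<Rightarrow> letter \<Rightarrow> letter" where
  "rename x y t = (if t = x then La else if t = y then Lb else Lc)"

lemma bij_rename: "x \<noteq> y \<Longrightarrow> bij (rename x y)"
proof (rule bijI)
  assume xy: "x \<noteq> y"
  show inj: "inj (rename x y)"
  proof (rule injI)
    fix s t assume "rename x y s = rename x y t"
    then show "s = t" using xy unfolding rename_def
      by (cases x; cases y; cases s; cases t; simp)
  qed
  show "surj (rename x y)"
  proof (rule surjI)
    fix t
    show "rename x y (case t of La \<Rightarrow> x | Lb \<Rightarrow> y | Lc \<Rightarrow> third x y) = t"
      using xy unfolding rename_def by (cases x; cases y; cases t; simp)
  qed
qed

section \<open>The missing lengths\<close>

definition gaps :: "nat list" where
  "gaps = [2, 3, 5, 7, 9, 10, 11, 12, 14, 17, 19, 25, 26, 27, 29, 31, 37]"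

definition flags :: "nat \<Rightarrow> nat \<Rightarrow> bool list" where
  "flags a b = map (\<lambda>n. n \<in> set gaps) [a..<b]"

lemma search_not_extremal:
  assumes search: "search j k P (flags l b) r" "length r = l"
    and w: "prefix (rev r) w" "r \<noteq> []" "length w \<in> set gaps" "length w < b" "2 * j \<le> length w"
    and P: "\<And>u s. w = rev u @ s \<Longrightarrow> \<not> P u"
  shows "\<not> extremal_square_free (circular_word w)"
proof
  assume extremal: "extremal_square_free (circular_word w)"
  obtain v where v: "w = rev r @ v" using w(1) by (auto simp: prefix_def)
  have "square_free w"
    using extremal self_in_circular_word[of w]
    unfolding extremal_square_free_def circular_square_free_def by blast
  then have "not_extremal j (rev v @ r) (rev r @ v)"
    using w v P search(2) by (intro search_sound[OF search(1)]) (auto simp: flags_def)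
  then have "not_extremal j (rev v @ r) w" unfolding v .
  moreover have "w = rev (rev v @ r)" "w \<noteq> []" using w(2) unfolding v by auto
  ultimately show False using not_extremal_sound w(5) extremal by blast
qed

text \<open>Words of length at most 17 have no squares of period above 8, so all squares are pruned
  here. The seam window is empty because the lengths go down to 2.\<close>

lemma small_search: "search 0 8 (\<lambda>_. False) (flags 2 18) [Lb, La]"
  by code_simp

text \<open>The largest gap is 37, whence the bound 38. The starting word is abac, reversed.\<close>

lemma pattern_free_search: "search 8 8 ends_in_pattern (flags 4 38) [Lc, La, Lb, La]"
  by code_simp

text \<open>The complementary case, with the seven letters of abcacbc fixed at the start.\<close>

lemma pattern_search: "search 8 8 (\<lambda>_. False) (flags 7 38) [Lc, Lb, Lc, La, Lc, Lb, La]"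
  by code_simp

lemma pattern_not_extremal:
  fixes w :: "letter list"
  assumes v: "v \<in> circular_word w" "prefix [x, y, z, x, z, y, z] v"
    and ne: "x \<noteq> y" "z \<noteq> x" "z \<noteq> y" and len: "length w \<in> set gaps" "16 \<le> length w"
  shows "\<not> extremal_square_free (circular_word w)"
proof
  let ?f = "rename x y"
  assume "extremal_square_free (circular_word w)"
  then have "extremal_square_free (circular_word (map ?f v))"
    unfolding circular_word_sym[OF v(1), symmetric]
    by (rule extremal_square_free_map[OF bij_rename[OF ne(1)]])
  moreover have "\<not> extremal_square_free (circular_word (map ?f v))"
  proof (rule search_not_extremal[where r = "[Lc, Lb, Lc, La, Lc, Lb, La]" and P = "\<lambda>_. False"])
    show "search 8 8 (\<lambda>_. False) (flags 7 38) [Lc, Lb, Lc, La, Lc, Lb, La]"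
      by (rule pattern_search)
    show "prefix (rev [Lc, Lb, Lc, La, Lc, Lb, La]) (map ?f v)"
      using map_mono_prefix[OF v(2), of ?f] ne by (simp add: rename_def)
    show "length (map ?f v) \<in> set gaps" "length (map ?f v) < 38" "2 * 8 \<le> length (map ?f v)"
      using len length_circular_word[OF v(1)] by (auto simp: gaps_def)
  qed simp_all
  ultimately show False by blast
qed

text \<open>Otherwise any three consecutive letters among the first six are distinct. Over three
  letters each is then determined by the two before it, so these six letters have period 3 and form
  a square.\<close>

lemma ex_letter_two_apart:
  fixes w :: "letter list"
  assumes "square_free w" "6 \<le> length w"
  shows "\<exists>i\<le>3. w ! i = w ! (i + 2)"
proof (rule ccontr)
  assume *: "\<not> ?thesis"
  have neq: "w ! i \<noteq> w ! Suc i" if "i \<le> 4" for i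
    using square_free_nth_Suc_neq[OF assms(1)] that assms(2) by simp
  have third: "a = d" if "a \<noteq> b" "b \<noteq> c" "a \<noteq> c" "c \<noteq> d" "b \<noteq> d" for a b c d :: letter
    using that by (cases a; cases b; cases c; cases d; simp)
  have "w ! i = w ! (i + 3)" if "i < 3" for i
  proof (rule third[of _ "w ! Suc i" "w ! (i + 2)"])
    have "Suc i \<le> 3" "i \<le> 3" using that by simp_all
    then show "w ! i \<noteq> w ! (i + 2)" using * by blast
    have "w ! Suc i \<noteq> w ! (Suc i + 2)" using * \<open>Suc i \<le> 3\<close> by blast
    then show "w ! Suc i \<noteq> w ! (i + 3)" by (simp add: numeral_3_eq_3)
    show "w ! i \<noteq> w ! Suc i" using neq[of i] that by simp
    show "w ! Suc i \<noteq> w ! (i + 2)" using neq[of "Suc i"] that by (simp add: numeral_2_eq_2)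
    show "w ! (i + 2) \<noteq> w ! (i + 3)"
      using neq[of "i + 2"] that by (simp add: numeral_2_eq_2 numeral_3_eq_3)
  qed
  then have "\<forall>r<3. w ! (0 + r) = w ! (0 + 3 + r)" by (simp add: add.commute)
  moreover have "0 < (3 :: nat)" "0 + 2 * 3 \<le> length w" using assms(2) by simp_all
  ultimately show False using assms(1) unfolding square_free_iff_nth by blast
qed

text \<open>Rotation brings two equal letters at distance two to the front. The letter after them
  differs from the one in between, since xyxy is a square.\<close>

lemma ex_conjugate_prefix:
  fixes w :: "letter list"
  assumes sf: "circular_square_free (circular_word w)" and len: "6 \<le> length w"
  shows "\<exists>v\<in>circular_word w. \<exists>x y z. x \<noteq> y \<and> z \<noteq> x \<and> z \<noteq> y \<and> prefix [x, y, x, z] v"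
proof -
  have "square_free w" using sf self_in_circular_word unfolding circular_square_free_def by blast
  then obtain i where i: "i \<le> 3" "w ! i = w ! (i + 2)" using ex_letter_two_apart len by blast
  define v where "v = drop i w @ take i w"
  have v: "v \<in> circular_word w"
    using append_commute_circular_word[of "drop i w" "take i w"] unfolding v_def by simp
  then have sf_v: "square_free v" using sf unfolding circular_square_free_def by blast
  have "length v = length w" by (rule length_circular_word[OF v])
  then obtain x y x' z s where xyz: "v = x # y # x' # z # s"
    using len by (cases v; cases "tl v"; cases "tl (tl v)"; cases "tl (tl (tl v))") auto
  have "x = v ! 0" "x' = v ! 2" unfolding xyz by simp_all
  moreover have "i < length w" "2 < length w - i" using i(1) len by arith+
  ultimately have x': "x' = x" using i(2) unfolding v_def by (simp add: nth_append add.commute)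
  have "x \<noteq> y" "x' \<noteq> z"
    using square_free_nth_Suc_neq[OF sf_v, of 0] square_free_nth_Suc_neq[OF sf_v, of 2]
    unfolding xyz by (simp_all add: eval_nat_numeral)
  moreover have "z \<noteq> y"
  proof
    assume "z = y"
    then have "v = [] @ ([x, y] @ [x, y]) @ s" using x' xyz by simp
    then have "sublist ([x, y] @ [x, y]) v" by (metis sublist_appendI)
    then show False using sf_v unfolding square_free_def by blast
  qed
  ultimately show ?thesis using v x' xyz by (intro bexI[of _ v]) auto
qed

lemma not_extremal_gap:
  fixes w :: "letter list"
  assumes "length w \<in> {0, 1} \<union> set gaps"
  shows "\<not> extremal_square_free (circular_word w)"
proof
  assume extremal: "extremal_square_free (circular_word w)"
  then have sf: "circular_square_free (circular_word w)" unfolding extremal_square_free_def by blast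
  then have sf_w: "square_free w" using self_in_circular_word unfolding circular_square_free_def by blast
  \<comment> \<open>18 is not a gap. All longer words have room for the seam window of 8 letters on
    either side.\<close>
  consider "length w = 0" | "length w = 1" | "2 \<le> length w" "length w \<le> 17" | "18 < length w"
    using assms by (auto simp: gaps_def)
  then show False
  proof cases
    case 1
    then have "\<not> circular_square_free (circular_word [La])"
      using extremal self_in_circular_word[of w] unfolding extremal_square_free_iff by auto
    then show False unfolding circular_square_iff[symmetric] by code_simp
  next
    case 2
    then obtain x where x: "w = [x]" by (cases w) auto
    obtain a where "a \<noteq> x" by (cases x) auto
    moreover have "\<not> circular_square_free (circular_word [a, x])"
      using extremal self_in_circular_word[of w] unfolding extremal_square_free_iff x by auto
    ultimately show False
      unfolding circular_square_iff[symmetric] circular_square_def has_square_def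
      by (cases a; cases x; simp)
  next
    case 3
    then obtain x y s where w: "w = x # y # s" by (cases w; cases "tl w") auto
    have xy: "x \<noteq> y" using square_free_nth_Suc_neq[OF sf_w, of 0] unfolding w by simp
    have "\<not> extremal_square_free (circular_word (map (rename x y) w))"
    proof (rule search_not_extremal[where r = "[Lb, La]" and P = "\<lambda>_. False"])
      show "search 0 8 (\<lambda>_. False) (flags 2 18) [Lb, La]" by (rule small_search)
      show "prefix (rev [Lb, La]) (map (rename x y) w)" using xy unfolding w by (simp add: rename_def)
      show "length (map (rename x y) w) \<in> set gaps" using assms 3 by auto
    qed (use 3 in simp_all)
    then show False using extremal_square_free_map[OF bij_rename[OF xy] extremal] by blast
  next
    case 4
    then have gap: "length w \<in> set gaps" using assms by auto
    obtain v x y z where v: "v \<in> circular_word w" "x \<noteq> y" "z \<noteq> x" "z \<noteq> y" "prefix [x, y, x, z] v"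
      using ex_conjugate_prefix[OF sf] 4 by auto
    let ?w = "map (rename x y) v"
    have extremal': "extremal_square_free (circular_word ?w)"
      using extremal_square_free_map[OF bij_rename[OF v(2)], of v] extremal
      unfolding circular_word_sym[OF v(1)] by blast
    then have sf': "square_free ?w"
      using self_in_circular_word[of ?w] unfolding extremal_square_free_def circular_square_free_def by blast
    have len: "length ?w = length w" using length_circular_word[OF v(1)] by simp
    have "\<not> extremal_square_free (circular_word ?w)"
    proof (rule search_not_extremal[where r = "[Lc, La, Lb, La]" and P = ends_in_pattern])
      show "search 8 8 ends_in_pattern (flags 4 38) [Lc, La, Lb, La]" by (rule pattern_free_search)
      show "prefix (rev [Lc, La, Lb, La]) ?w"
        using map_mono_prefix[OF v(5), of "rename x y"] v(2-4) by (simp add: rename_def)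
      show "length ?w < 38" using gap unfolding len by (auto simp: gaps_def)
      fix u s assume us: "?w = rev u @ s"
      \<comment> \<open>A factor xyzxzyz could be rotated to the front, which is the case excluded
        before.\<close>
      show "\<not> ends_in_pattern u"
      proof
        assume "ends_in_pattern u"
        then obtain x' y' z' t where u: "u = z' # y' # z' # x' # z' # y' # x' # t"
          by (cases u rule: ends_in_pattern.cases) (auto split: if_splits)
        let ?p = "[x', y', z', x', z', y', z']"
        have w': "?w = rev t @ ?p @ s" unfolding us u by simp
        have "square_free ?p"
          by (rule square_free_sublist[OF sf']) (simp only: w' sublist_appendI)
        then have "x' \<noteq> y'" "z' \<noteq> x'" "z' \<noteq> y'"
          using square_free_nth_Suc_neq[of ?p 0] square_free_nth_Suc_neq[of ?p 2]
            square_free_nth_Suc_neq[of ?p 1] by (simp_all add: eval_nat_numeral)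
        moreover have "?p @ s @ rev t \<in> circular_word ?w"
          using append_commute_circular_word[of "?p @ s" "rev t"] unfolding w' by simp
        moreover have "prefix ?p (?p @ s @ rev t)" by (rule prefixI) (rule refl)
        ultimately show False
          using pattern_not_extremal[of "?p @ s @ rev t" ?w x' y' z'] extremal' gap 4 unfolding len by simp
      qed
    qed (use gap 4 len in simp_all)
    then show False using extremal' by blast
  qed
qed

section \<open>Explicit words\<close>

text \<open>The words of this section were found by computer search.\<close>

definition marker :: "letter list" where
  "marker = [La, Lb, Lc, La, Lb]"

definition block_a :: "letter list" where
  "block_a =
    [La, Lb, Lc, La, Lb, La, Lc, Lb, Lc, La, Lb, Lc, Lb, La, Lb, Lc, La, Lc, Lb, Lc, La, Lb, La,
    Lc, La, Lb, Lc, Lb]"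

definition block_b :: "letter list" where
  "block_b =
    [La, Lb, Lc, La, Lb, La, Lc, Lb, Lc, La, Lb, Lc, Lb, La, Lc, La, Lb, Lc, La, Lc, Lb, La, Lc,
    La, Lb, La, Lc, Lb]"

definition block_c :: "letter list" where
  "block_c =
    [La, Lb, Lc, La, Lb, La, Lc, Lb, Lc, La, Lb, Lc, Lb, La, Lc, Lb, Lc, La, Lc, Lb, La, Lc, La,
    Lb, Lc, La, Lc, Lb]"

text \<open>Ordered by residue: the entry at index i has a length congruent to i modulo 28. Those of
  length 32 and 36 also realise these two lengths.\<close>

definition connectors :: "letter list list" where
  "connectors =
   [[La, Lb, Lc, La, Lb, La, Lc, Lb, Lc, La, Lb, Lc, Lb, La, Lb, Lc, La, Lc, Lb, La, Lc, La, Lb,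
    La, Lc, Lb, Lc, La, Lc, Lb, La, Lc, La, Lb, Lc, Lb, La, Lb, Lc, La, Lc, Lb, La, Lc, La, Lb,
    Lc, La, Lc, Lb, Lc, La, Lb, La, Lc, Lb],
    [La, Lb, Lc, La, Lb, La, Lc, Lb, Lc, La, Lb, Lc, Lb, La, Lb, Lc, La, Lc, Lb, Lc, La, Lb, La,
    Lc, Lb, La, Lb, Lc, La, Lc, Lb, La, Lc, La, Lb, La, Lc, Lb, Lc, La, Lc, Lb, La, Lc, La, Lb,
    Lc, Lb, La, Lc, Lb, Lc, La, Lb, La, Lc, Lb],
    [La, Lb, Lc, La, Lb, La, Lc, Lb, Lc, La, Lb, Lc, Lb, La, Lb, Lc, La, Lc, Lb, Lc, La, Lb, La,
    Lc, Lb, La, Lb, Lc, La, Lc, Lb, La, Lc, La, Lb, La, Lc, Lb, La, Lb, Lc, La, Lc, Lb, Lc, La,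
    Lb, Lc, Lb, La, Lc, Lb, Lc, La, Lb, La, Lc, Lb],
    [La, Lb, Lc, La, Lb, La, Lc, Lb, Lc, La, Lb, Lc, Lb, La, Lb, Lc, La, Lc, Lb, Lc, La, Lb, Lc,
    Lb, La, Lc, La, Lb, La, Lc, Lb, La, Lb, Lc, La, Lc, Lb, La, Lc, La, Lb, Lc, La, Lc, Lb, Lc,
    La, Lb, Lc, Lb, La, Lc, Lb, Lc, La, Lb, La, Lc, Lb],
    [La, Lb, Lc, La, Lb, La, Lc, Lb, Lc, La, Lb, Lc, Lb, La, Lc, La, Lb, Lc, La, Lc, Lb, Lc, La,
    Lb, La, Lc, La, Lb, Lc, La, Lc, Lb],
    [La, Lb, Lc, La, Lb, La, Lc, Lb, Lc, La, Lb, Lc, Lb, La, Lb, Lc, La, Lc, Lb, La, Lc, La, Lb,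
    La, Lc, Lb, Lc, La, Lc, Lb, La, Lc, La, Lb, Lc, La, Lc, Lb, La, Lb, Lc, Lb, La, Lc, La, Lb,
    Lc, La, Lc, Lb, Lc, La, Lb, La, Lc, La, Lb, Lc, La, Lc, Lb],
    [La, Lb, Lc, La, Lb, La, Lc, Lb, Lc, La, Lb, Lc, Lb, La, Lb, Lc, La, Lc, Lb, La, Lc, La, Lb,
    Lc, Lb, La, Lc, Lb, Lc, La, Lc, Lb, La, Lb, Lc, Lb, La, Lc, La, Lb, La, Lc, Lb, Lc, La, Lc,
    Lb, La, Lc, La, Lb, Lc, Lb, La, Lc, Lb, Lc, La, Lb, La, Lc, Lb],
    [La, Lb, Lc, La, Lb, La, Lc, Lb, Lc, La, Lb, Lc, Lb, La, Lb, Lc, La, Lc, Lb, La, Lc, La, Lb,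
    La, Lc, Lb, Lc, La, Lc, Lb, La, Lc, La, Lb, Lc, Lb, La, Lb, Lc, La, Lc, Lb, La, Lc, La, Lb,
    Lc, La, Lc, Lb, Lc, La, Lb, Lc, Lb, La, Lc, La, Lb, Lc, La, Lc, Lb],
    [La, Lb, Lc, La, Lb, La, Lc, Lb, Lc, La, Lb, Lc, Lb, La, Lb, Lc, La, Lc, Lb, La, Lc, La, Lb,
    La, Lc, Lb, Lc, La, Lc, Lb, La, Lc, La, Lb, Lc, Lb],
    [La, Lb, Lc, La, Lb, La, Lc, Lb, Lc, La, Lb, Lc, Lb, La, Lb, Lc, La, Lc, Lb, La, Lc, La, Lb,
    La, Lc, Lb, Lc, La, Lc, Lb, La, Lc, La, Lb, Lc, Lb, La, Lc, Lb, Lc, La, Lb, La, Lc, La, Lb,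
    Lc, La, Lc, Lb, La, Lc, La, Lb, Lc, Lb, La, Lc, Lb, Lc, La, Lb, La, Lc, Lb],
    [La, Lb, Lc, La, Lb, La, Lc, Lb, Lc, La, Lb, Lc, Lb, La, Lb, Lc, La, Lc, Lb, La, Lc, La, Lb,
    La, Lc, Lb, Lc, La, Lc, Lb, La, Lc, La, Lb, Lc, Lb, La, Lb, Lc, La, Lc, Lb, Lc, La, Lb, Lc,
    Lb, La, Lc, La, Lb, Lc, La, Lc, Lb, La, Lb, Lc, Lb, La, Lc, La, Lb, La, Lc, Lb],
    [La, Lb, Lc, La, Lb, La, Lc, Lb, Lc, La, Lb, Lc, Lb, La, Lb, Lc, La, Lc, Lb, La, Lc, La, Lb,
    La, Lc, Lb, Lc, La, Lc, Lb, La, Lc, La, Lb, Lc, Lb, La, Lc, Lb, Lc, La, Lb, La, Lc, La, Lb,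
    Lc, Lb, La, Lb, Lc, La, Lc, Lb, Lc, La, Lb, Lc, Lb, La, Lc, La, Lb, Lc, La, Lc, Lb],
    [La, Lb, Lc, La, Lb, La, Lc, Lb, Lc, La, Lb, Lc, Lb, La, Lc, Lb, Lc, La, Lc, Lb, La, Lb, Lc,
    La, Lc, Lb, Lc, La, Lb, Lc, Lb, La, Lc, Lb, Lc, La, Lb, La, Lc, Lb],
    [La, Lb, Lc, La, Lb, La, Lc, Lb, Lc, La, Lb, Lc, Lb, La, Lb, Lc, La, Lc, Lb, La, Lc, La, Lb,
    La, Lc, Lb, Lc, La, Lc, Lb, La, Lc, La, Lb, Lc, Lb, La, Lb, Lc, La, Lc, Lb, La, Lc, La, Lb,
    Lc, La, Lc, Lb, Lc, La, Lb, La, Lc, Lb, La, Lb, Lc, Lb, La, Lc, Lb, Lc, La, Lb, La, Lc, Lb],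
    [La, Lb, Lc, La, Lb, La, Lc, Lb, Lc, La, Lb, Lc, Lb, La, Lb, Lc, La, Lc, Lb, La, Lc, La, Lb,
    La, Lc, Lb, Lc, La, Lc, Lb, La, Lc, La, Lb, Lc, Lb, La, Lb, Lc, La, Lc, Lb, Lc, La, Lb, Lc,
    Lb, La, Lc, La, Lb, Lc, La, Lc, Lb, La, Lc, La, Lb, Lc, Lb, La, Lc, Lb, Lc, La, Lb, La, Lc,
    Lb],
    [La, Lb, Lc, La, Lb, La, Lc, Lb, Lc, La, Lb, Lc, Lb, La, Lb, Lc, La, Lc, Lb, Lc, La, Lb, Lc,
    Lb, La, Lc, La, Lb, La, Lc, Lb, Lc, La, Lb, Lc, Lb, La, Lc, Lb, Lc, La, Lc, Lb],
    [La, Lb, Lc, La, Lb, La, Lc, Lb, Lc, La, Lb, Lc, Lb, La, Lb, Lc, La, Lc, Lb, La, Lc, La, Lb,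
    La, Lc, Lb, Lc, La, Lc, Lb, La, Lc, La, Lb, Lc, La, Lc, Lb, La, Lb, Lc, Lb, La, Lc, La, Lb,
    Lc, La, Lc, Lb, Lc, La, Lb, La, Lc, La, Lb, Lc, La, Lc, Lb, La, Lb, Lc, Lb, La, Lc, La, Lb,
    La, Lc, Lb],
    [La, Lb, Lc, La, Lb, La, Lc, Lb, Lc, La, Lb, Lc, Lb, La, Lb, Lc, La, Lc, Lb, La, Lc, La, Lb,
    La, Lc, Lb, Lc, La, Lc, Lb, La, Lc, La, Lb, Lc, Lb, La, Lc, Lb, Lc, La, Lb, La, Lc, Lb],
    [La, Lb, Lc, La, Lb, La, Lc, Lb, Lc, La, Lb, Lc, Lb, La, Lc, Lb, Lc, La, Lb, La, Lc, Lb, La,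
    Lb, Lc, La, Lc, Lb, Lc, La, Lb, La, Lc, La, Lb, Lc, Lb, La, Lc, Lb, Lc, La, Lb, La, Lc, Lb],
    [La, Lb, Lc, La, Lb, La, Lc, Lb, Lc, La, Lb, Lc, Lb, La, Lb, Lc, La, Lc, Lb, Lc, La, Lb, Lc,
    Lb, La, Lc, La, Lb, Lc, La, Lc, Lb, La, Lc, La, Lb, Lc, Lb, La, Lc, Lb, Lc, La, Lb, La, Lc,
    Lb],
    [La, Lb, Lc, La, Lb, La, Lc, Lb, Lc, La, Lb, Lc, Lb, La, Lb, Lc, La, Lc, Lb, Lc, La, Lb, La,
    Lc, Lb, La, Lb, Lc, Lb, La, Lc, La, Lb, La, Lc, Lb, La, Lb, Lc, La, Lc, Lb, Lc, La, Lb, La,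
    Lc, Lb],
    [La, Lb, Lc, La, Lb, La, Lc, Lb, Lc, La, Lb, Lc, Lb, La, Lc, La, Lb, Lc, La, Lc, Lb, Lc, La,
    Lb, La, Lc, La, Lb, Lc, Lb, La, Lb, Lc, La, Lc, Lb, Lc, La, Lb, Lc, Lb, La, Lc, La, Lb, Lc,
    La, Lc, Lb],
    [La, Lb, Lc, La, Lb, La, Lc, Lb, Lc, La, Lb, Lc, Lb, La, Lb, Lc, La, Lc, Lb, La, Lc, La, Lb,
    La, Lc, Lb, Lc, La, Lc, Lb, La, Lc, La, Lb, Lc, Lb, La, Lc, Lb, Lc, La, Lb, La, Lc, La, Lb,
    Lc, La, Lc, Lb],
    [La, Lb, Lc, La, Lb, La, Lc, Lb, Lc, La, Lb, Lc, Lb, La, Lc, La, Lb, Lc, La, Lc, Lb, Lc, La,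
    Lb, Lc, Lb, La, Lc, Lb, Lc, La, Lc, Lb, La, Lc, La, Lb, Lc, Lb, La, Lc, Lb, Lc, La, Lb, La,
    Lc, La, Lb, Lc, Lb],
    [La, Lb, Lc, La, Lb, La, Lc, Lb, Lc, La, Lb, Lc, Lb, La, Lb, Lc, La, Lc, Lb, La, Lc, La, Lb,
    La, Lc, Lb, Lc, La, Lc, Lb, La, Lc, La, Lb, Lc, Lb, La, Lc, Lb, Lc, La, Lb, Lc, Lb, La, Lc,
    La, Lb, Lc, La, Lc, Lb],
    [La, Lb, Lc, La, Lb, La, Lc, Lb, Lc, La, Lb, Lc, Lb, La, Lb, Lc, La, Lc, Lb, La, Lc, La, Lb,
    La, Lc, Lb, Lc, La, Lc, Lb, La, Lc, La, Lb, Lc, Lb, La, Lb, Lc, La, Lc, Lb, Lc, La, Lb, La,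
    Lc, La, Lb, Lc, La, Lc, Lb],
    [La, Lb, Lc, La, Lb, La, Lc, Lb, Lc, La, Lb, Lc, Lb, La, Lb, Lc, La, Lc, Lb, Lc, La, Lb, Lc,
    Lb, La, Lc, La, Lb, La, Lc, Lb, La, Lb, Lc, Lb, La, Lc, La, Lb, Lc, La, Lc, Lb, Lc, La, Lb,
    La, Lc, La, Lb, Lc, La, Lc, Lb],
    [La, Lb, Lc, La, Lb, La, Lc, Lb, Lc, La, Lb, Lc, Lb, La, Lb, Lc, La, Lc, Lb, La, Lc, La, Lb,
    La, Lc, Lb, Lc, La, Lc, Lb, La, Lc, La, Lb, Lc, Lb, La, Lb, Lc, La, Lc, Lb, Lc, La, Lb, Lc,
    Lb, La, Lc, La, Lb, Lc, La, Lc, Lb]]"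

text \<open>These have the admissible lengths below 38 other than 32 and 36, and the lengths 38, 39,
  41, 42, 44, whose connectors are longer by 28.\<close>

definition sporadic_words :: "letter list list" where
  "sporadic_words =
   [[La, Lb, La, Lc],
    [La, Lb, La, Lc, Lb, Lc],
    [La, Lb, La, Lc, Lb, La, Lb, Lc],
    [La, Lb, La, Lc, La, Lb, Lc, La, Lc, Lb, La, Lb, Lc],
    [La, Lb, La, Lc, La, Lb, Lc, Lb, La, Lb, Lc, La, Lc, Lb, Lc],
    [La, Lb, La, Lc, La, Lb, Lc, Lb, La, Lc, La, Lb, La, Lc, Lb, Lc],
    [La, Lb, La, Lc, La, Lb, Lc, La, Lc, Lb, La, Lc, La, Lb, La, Lc, Lb, Lc],
    [La, Lb, La, Lc, La, Lb, Lc, La, Lc, Lb, La, Lc, La, Lb, La, Lc, Lb, La, Lb, Lc],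
    [La, Lb, La, Lc, Lb, La, Lb, Lc, La, Lc, Lb, La, Lc, La, Lb, Lc, Lb, La, Lc, Lb, Lc],
    [La, Lb, La, Lc, Lb, La, Lb, Lc, La, Lb, La, Lc, Lb, Lc, La, Lb, Lc, Lb, La, Lc, Lb, Lc],
    [La, Lb, La, Lc, La, Lb, Lc, La, Lc, Lb, La, Lb, Lc, Lb, La, Lc, La, Lb, Lc, La, Lc, Lb, Lc],
    [La, Lb, La, Lc, La, Lb, Lc, Lb, La, Lb, Lc, La, Lc, Lb, La, Lc, La, Lb, Lc, Lb, La, Lc, Lb,
    Lc],
    [La, Lb, La, Lc, La, Lb, Lc, La, Lc, Lb, La, Lb, Lc, La, Lb, La, Lc, La, Lb, Lc, Lb, La, Lb,
    Lc, La, Lc, Lb, Lc],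
    [La, Lb, La, Lc, La, Lb, Lc, La, Lc, Lb, La, Lb, Lc, La, Lb, La, Lc, Lb, Lc, La, Lb, Lc, Lb,
    La, Lb, Lc, La, Lc, Lb, Lc],
    [La, Lb, La, Lc, La, Lb, Lc, La, Lc, Lb, La, Lb, Lc, La, Lb, La, Lc, Lb, Lc, La, Lb, Lc, Lb,
    La, Lc, Lb, Lc, La, Lc, Lb, La, Lb, Lc],
    [La, Lb, La, Lc, La, Lb, Lc, La, Lc, Lb, La, Lb, Lc, La, Lb, La, Lc, Lb, La, Lb, Lc, La, Lc,
    Lb, La, Lc, La, Lb, La, Lc, Lb, La, Lb, Lc],
    [La, Lb, La, Lc, La, Lb, Lc, La, Lc, Lb, La, Lb, Lc, La, Lb, La, Lc, Lb, Lc, La, Lc, Lb, La,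
    Lb, Lc, Lb, La, Lc, La, Lb, Lc, La, Lc, Lb, Lc],
    [La, Lb, La, Lc, La, Lb, Lc, La, Lc, Lb, La, Lb, Lc, La, Lb, La, Lc, Lb, Lc, La, Lb, Lc, Lb,
    La, Lb, Lc, La, Lb, La, Lc, Lb, Lc, La, Lc, Lb, La, Lb, Lc],
    [La, Lb, La, Lc, La, Lb, Lc, La, Lc, Lb, La, Lb, Lc, La, Lb, La, Lc, Lb, La, Lb, Lc, Lb, La,
    Lc, Lb, Lc, La, Lb, Lc, Lb, La, Lc, La, Lb, Lc, La, Lc, Lb, Lc],
    [La, Lb, La, Lc, La, Lb, Lc, La, Lc, Lb, La, Lb, Lc, La, Lb, La, Lc, La, Lb, Lc, Lb, La, Lb,
    Lc, La, Lb, La, Lc, Lb, Lc, La, Lb, Lc, Lb, La, Lb, Lc, La, Lc, Lb, Lc],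
    [La, Lb, La, Lc, La, Lb, Lc, La, Lc, Lb, La, Lb, Lc, La, Lb, La, Lc, Lb, Lc, La, Lc, Lb, La,
    Lb, Lc, Lb, La, Lc, Lb, Lc, La, Lb, La, Lc, Lb, La, Lb, Lc, La, Lc, Lb, Lc],
    [La, Lb, La, Lc, La, Lb, Lc, La, Lc, Lb, La, Lc, La, Lb, Lc, Lb, La, Lc, Lb, Lc, La, Lb, La,
    Lc, Lb, La, Lb, Lc, La, Lb, La, Lc, La, Lb, Lc, Lb, La, Lc, La, Lb, La, Lc, Lb, Lc]]"

section \<open>Extremal words of all large lengths\<close>

fun lcp :: "'a list \<Rightarrow> 'a list \<Rightarrow> nat" where
  "lcp (x # xs) (y # ys) = (if x = y then Suc (lcp xs ys) else 0)"
| "lcp xs ys = 0"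

text \<open>Appending \<open>marker\<close> makes occurrences visible that begin in the block and
  end in the next one.\<close>

fun no_marker :: "letter list \<Rightarrow> bool" where
  "no_marker [] = True"
| "no_marker (x # xs) =
    (if agree (length marker) marker (x # xs @ marker) then False else no_marker xs)"

definition good_block :: "letter list \<Rightarrow> bool" where
  "good_block X \<longleftrightarrow> agree (length marker) marker X \<and> no_marker (tl X)"

definition good_pair :: "letter list \<Rightarrow> letter list \<Rightarrow> bool" where
  "good_pair X Y \<longleftrightarrow>
    (if X = Y then True else \<not> contains_square (X @ Y @ marker))"

text \<open>The numerical form of \<open>cut\<close>: if the common prefix with \<open>Y\<close> and
  the common suffix with \<open>Z\<close> do not cover \<open>X\<close>, then \<open>X\<close> does
  not split into a prefix of \<open>Y\<close> and a suffix of \<open>Z\<close>.\<close>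

definition good_triple :: "letter list \<Rightarrow> letter list \<Rightarrow> letter list \<Rightarrow> bool" where
  "good_triple X Y Z \<longleftrightarrow>
    (if X = Y then True else if X = Z then True else lcp X Y + lcp (rev X) (rev Z) < length X)"

definition good_blocks :: "letter list list \<Rightarrow> bool" where
  "good_blocks Xs \<longleftrightarrow> list_all good_block Xs \<and> list_all (\<lambda>X. list_all (good_pair X) Xs) Xs \<and>
     list_all (\<lambda>X. list_all (\<lambda>Y. list_all (good_triple X Y) Xs) Xs) Xs"

lemma lcp_prefix: "prefix p xs \<Longrightarrow> prefix p ys \<Longrightarrow> length p \<le> lcp xs ys"
proof (induction xs ys arbitrary: p rule: lcp.induct)
  case (1 x xs y ys)
  then show ?case by (cases p) auto
qed auto

lemma agree_marker_iff: "agree (length marker) marker xs \<longleftrightarrow> prefix marker xs"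
proof -
  have "length marker \<le> length xs" if "take (length marker) xs = marker"
    using arg_cong[OF that, of length] by simp
  then show ?thesis unfolding agree_iff prefix_iff_take by auto
qed

lemma no_marker_drop:
  "no_marker xs \<Longrightarrow> j < length xs \<Longrightarrow> \<not> prefix marker (drop j xs @ marker)"
proof (induction xs arbitrary: j)
  case (Cons x xs)
  then show ?case by (cases j) (auto simp: agree_marker_iff split: if_splits)
qed simp

lemma good_block_occurrence:
  assumes "good_block X" "X @ marker = p @ marker @ s"
  shows "p = [] \<or> s = []"
proof (rule ccontr)
  assume *: "\<not> (p = [] \<or> s = [])"
  have "length X = length p + length s" using arg_cong[OF assms(2), of length] by simp
  then have len: "0 < length p" "length p < length X" using * by auto
  have "prefix marker (drop (length p) (X @ marker))" unfolding assms(2) by simp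
  then have "prefix marker (drop (length p - 1) (tl X) @ marker)"
    using len by (simp add: drop_tl[symmetric] drop_Suc[symmetric])
  moreover have "\<not> prefix marker (drop (length p - 1) (tl X) @ marker)"
  proof (rule no_marker_drop)
    show "no_marker (tl X)" using assms(1) unfolding good_block_def by simp
    show "length p - 1 < length (tl X)" unfolding length_tl using len by arith
  qed
  ultimately show False by blast
qed

text \<open>Only pairs of different blocks are tested for squares. A single block with the marker is
  a factor of such a pair, and this takes two distinct letters.\<close>

lemma marked_blocks_if_good_blocks:
  fixes g :: "'l \<Rightarrow> letter list"
  assumes good: "good_blocks Xs" and range: "range g \<subseteq> set Xs" and inj: "inj g"
    and two: "x\<^sub>0 \<noteq> (x\<^sub>1 :: 'l)"
  shows "marked_blocks g marker"
proof
  have block: "good_block (g x)" and pair: "good_pair (g x) (g y)"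
    and triple: "good_triple (g x) (g y) (g z)" for x y z
    using good range unfolding good_blocks_def list_all_iff by (auto simp: image_subset_iff)
  show "marker \<noteq> []" by (simp add: marker_def)
  show "prefix marker (g x)" for x
    using block[of x] by (simp add: good_block_def agree_marker_iff)
  show "p = [] \<or> s = []" if "g x @ marker = p @ marker @ s" for x p s
    using good_block_occurrence[OF block that] .
  show sf: "square_free (g x @ g y @ marker)" if "x \<noteq> y" for x y
    using pair[of x y] injD[OF inj] that
    unfolding good_pair_def contains_square_iff by (auto split: if_splits)
  show "square_free (g x @ marker)" for x
  proof -
    obtain y where "y \<noteq> x" using two by metis
    then show ?thesis by (rule square_free_sublist[OF sf]) simp
  qed
  show "x = y \<or> x = z" if "g x = p @ s" "prefix p (g y)" "suffix s (g z)" for x y z p s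
  proof (rule ccontr)
    assume "\<not> (x = y \<or> x = z)"
    then have "lcp (g x) (g y) + lcp (rev (g x)) (rev (g z)) < length (g x)"
      using triple[of x y z] injD[OF inj] unfolding good_triple_def by (auto split: if_splits)
    moreover have "length p \<le> lcp (g x) (g y)" using that by (intro lcp_prefix) auto
    moreover have "length (rev s) \<le> lcp (rev (g x)) (rev (g z))"
      using that by (intro lcp_prefix) (auto simp: suffix_to_prefix)
    ultimately show False using that(1) by simp
  qed
qed

section \<open>Square-free words of every length, closed up by a connector\<close>

lemma le_power_28: "k \<le> 28 ^ k"
proof (induction k)
  case (Suc k)
  moreover have "1 \<le> (28 :: nat) ^ k" by simp
  ultimately show ?case unfolding power_Suc by linarith
qed simp

text \<open>Iterating the morphism on one letter gives square-free words of length
  \<open>28 ^ k\<close>, at least \<open>k\<close>; a prefix has the right length.\<close>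

lemma ex_square_free_word:
  fixes h :: "'l \<Rightarrow> 'l list"
  assumes "marked_blocks h m" "\<And>x. length (h x) = 28"
  shows "\<exists>w :: 'l list. square_free w \<and> length w = k"
proof -
  interpret marked_blocks h m by fact
  have "\<exists>w :: 'l list. square_free w \<and> length w = 28 ^ j" for j :: nat
  proof (induction j)
    case 0
    have "square_free [undefined :: 'l]" by (simp add: square_free_iff_nth) presburger
    then show ?case by (intro exI[of _ "[undefined]"]) simp
  next
    case (Suc j)
    then obtain w :: "'l list" where w: "square_free w" "length w = 28 ^ j" by blast
    have "length (concat (map h w)) = 28 ^ Suc j"
      using w(2) assms(2) by (simp add: length_concat sum_list_triv o_def)
    then show ?case using square_free_concat[OF w(1)] by blast
  qed
  then obtain w :: "'l list" where w: "square_free w" "length w = 28 ^ k" by blast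
  have "square_free (take k w)"
    by (rule square_free_sublist[OF w(1)]) (simp add: prefix_imp_sublist take_is_prefix)
  then show ?thesis using w(2) le_power_28[of k] by (intro exI[of _ "take k w"]) simp
qed

text \<open>A square contains each of its letters at least twice. As \<open>c\<close> occurs once,
  the square avoids it and lies in a copy of \<open>ws\<close>.\<close>

lemma square_free_around_letter:
  assumes "square_free ws" "c \<notin> set ws"
  shows "square_free (ws @ c # ws)"
  unfolding square_free_def
proof
  assume "\<exists>u. u \<noteq> [] \<and> sublist (u @ u) (ws @ c # ws)"
  then obtain u p s where u: "u \<noteq> []" "ws @ c # ws = p @ (u @ u) @ s" by (auto simp: sublist_def)
  have "count_list (ws @ c # ws) c = 1" using assms(2) by simp
  then have "c \<notin> set u" unfolding u(2) using count_list_0_iff[of u c] by auto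
  have prefix: "v = []" if "prefix v (c # ws)" "set v \<subseteq> set u" for v
    using that \<open>c \<notin> set u\<close> by (cases v) auto
  have "sublist (u @ u) (ws @ c # ws)" unfolding u(2) sublist_def by blast
  then have "sublist (u @ u) ws \<or> sublist (u @ u) (c # ws) \<or>
      (\<exists>v v'. u @ u = v @ v' \<and> suffix v ws \<and> prefix v' (c # ws))"
    unfolding sublist_append .
  moreover have "sublist (u @ u) ws" if "sublist (u @ u) (c # ws)"
    using that prefix[of "u @ u"] u(1) unfolding sublist_Cons_right by auto
  moreover have "sublist (u @ u) ws" if "u @ u = v @ v'" "suffix v ws" "prefix v' (c # ws)" for v v'
  proof -
    have "set v' \<subseteq> set (u @ u)" unfolding that(1) by simp
    then have "v' = []" using prefix[of v'] that(3) by simp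
    then show ?thesis using that(1,2) by (simp add: suffix_imp_sublist)
  qed
  ultimately have "sublist (u @ u) ws" by blast
  then show False using assms(1) u(1) unfolding square_free_def by blast
qed

text \<open>A square through one \<open>c\<close> contains the other one a period away. Their
  distance \<open>length ws + 1\<close> is too large for a period when \<open>ws\<close> is
  nonempty.\<close>

lemma square_free_between_letters:
  assumes "square_free ws" "c \<notin> set ws" "ws \<noteq> []"
  shows "square_free (c # ws @ [c])"
  unfolding square_free_iff_nth
proof
  let ?w = "c # ws @ [c]" and ?n = "length ws"
  assume "\<exists>i q. 0 < q \<and> i + 2 * q \<le> length ?w \<and> (\<forall>r<q. ?w ! (i + r) = ?w ! (i + q + r))"
  then obtain i q where q: "0 < q" "i + 2 * q \<le> ?n + 2"
    and eq: "\<And>r. r < q \<Longrightarrow> ?w ! (i + r) = ?w ! (i + q + r)" by auto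
  have inner: "?w ! j = ws ! (j - 1) \<and> ?w ! j \<noteq> c" if "1 \<le> j" "j \<le> ?n" for j
  proof -
    have "j - 1 < ?n" using that by simp
    then have "?w ! j = ws ! (j - 1)" using that by (simp add: nth_Cons' nth_append)
    moreover have "ws ! (j - 1) \<in> set ws" using that by simp
    ultimately show ?thesis using assms(2) by metis
  qed
  show False
  proof (cases "i = 0")
    case True
    then have "?w ! q = c" using eq[of 0] q by simp
    then have "\<not> q \<le> ?n" using inner[of q] q by auto
    moreover have "0 < ?n" using assms(3) by simp
    ultimately show False using q True by arith
  next
    case i: False
    show False
    proof (cases "i + 2 * q = ?n + 2")
      case True
      have "i + q + (q - 1) = Suc ?n" using True q by arith
      then have "?w ! (i + q + (q - 1)) = c" by (simp add: nth_append)
      then have "?w ! (i + (q - 1)) = c" using eq[of "q - 1"] q by simp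
      moreover have "1 \<le> i + (q - 1)" "i + (q - 1) \<le> ?n" using q i True by arith+
      ultimately show False using inner by metis
    next
      case False
      have "ws ! (i - 1 + r) = ws ! (i - 1 + q + r)" if "r < q" for r
        using inner[of "i + r"] inner[of "i + q + r"] eq[OF that] that q i False by simp
      moreover have "i - 1 + 2 * q \<le> ?n" using i q False by simp
      ultimately show False using assms(1) q(1) unfolding square_free_iff_nth by blast
    qed
  qed
qed

text \<open>A conjugate that starts in the connector is a factor of
  \<open>g None @ ?W @ g None\<close>, one that starts in \<open>?W\<close> is a factor of
  \<open>?W @ g None @ ?W\<close>. So two linear words settle the circular one.\<close>

lemma circular_square_free_connected:
  fixes g :: "'l option \<Rightarrow> 'a list"
  assumes "marked_blocks g m" "square_free w" "w \<noteq> []"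
  shows "circular_square_free (circular_word (concat (map g (None # map Some w))))"
proof -
  interpret marked_blocks g m by fact
  let ?ws = "map Some w" and ?W = "concat (map g (map Some w))"
  have ws: "square_free ?ws" using assms(2) by (rule square_free_map) simp
  have None: "None \<notin> set ?ws" by auto
  have sf1: "square_free (?W @ g None @ ?W)"
    using square_free_concat[OF square_free_around_letter[OF ws None]] by simp
  have sf2: "square_free (g None @ ?W @ g None)"
    using square_free_concat[OF square_free_between_letters[OF ws None]] assms(3) by simp
  have "square_free v" if v: "v \<in> circular_word (g None @ ?W)" for v
  proof -
    obtain x y where xy: "g None @ ?W = x @ y" "v = y @ x"
      using v by (auto simp: circular_word_def conjugate_def)
    then obtain t where "g None = x @ t \<and> t @ ?W = y \<or> g None @ t = x \<and> ?W = t @ y"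
      unfolding append_eq_append_conv2 by blast
    then show ?thesis
    proof
      assume t: "g None = x @ t \<and> t @ ?W = y"
      then have v: "v = t @ ?W @ x" using xy(2) by auto
      have "g None @ ?W @ g None = x @ v @ t" using t unfolding v by simp
      then show ?thesis using square_free_sublist[OF sf2, of v] by (simp add: sublist_appendI)
    next
      assume t: "g None @ t = x \<and> ?W = t @ y"
      then have v: "v = y @ g None @ t" using xy(2) by auto
      have "?W @ g None @ ?W = t @ v @ y" using t unfolding v by simp
      then show ?thesis using square_free_sublist[OF sf1, of v] by (simp add: sublist_appendI)
    qed
  qed
  then show ?thesis unfolding circular_square_free_def by simp
qed

section \<open>Insertions into blocks\<close>

text \<open>The window of 22 letters on either side keeps the test short and is wide enough for all
  blocks and connectors.\<close>

fun killed_at :: "letter list \<Rightarrow> letter list \<Rightarrow> bool" where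
  "killed_at (x # l) (y # r) =
    contains_square (rev (take 22 (x # l)) @ third x y # take 22 (y # r))"
| "killed_at l r = False"

text \<open>\<open>u\<close> holds the letters that the insertion place has yet to pass, and
  \<open>r\<close> is \<open>u\<close> followed by the marker. The place between the block and the
  marker is included.\<close>

fun killed :: "letter list \<Rightarrow> letter list \<Rightarrow> letter list \<Rightarrow> bool" where
  "killed l [] r = killed_at l r"
| "killed l (y # u) r = (if killed_at l r then killed (y # l) u (tl r) else False)"

lemma not_square_free_insert:
  assumes "killed_at l r" "square_free (rev l @ r)"
  shows "\<not> square_free (rev l @ a # r)"
proof -
  obtain x l' y r' where lr: "l = x # l'" "r = y # r'"
    using assms(1) by (cases l; cases r) auto
  have "x \<noteq> y"
    using square_free_nth_Suc_neq[OF assms(2), of "length l'"] unfolding lr by (auto simp: nth_append)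
  then consider "a = x" | "a = y" | "a = third x y" using third_cases by blast
  then show ?thesis
  proof cases
    case 1
    then have "rev l @ a # r = rev l' @ ([x] @ [x]) @ r" unfolding lr by simp
    then have "sublist ([x] @ [x]) (rev l @ a # r)" by (metis sublist_appendI)
    then show ?thesis unfolding square_free_def by blast
  next
    case 2
    then have "rev l @ a # r = rev l @ ([y] @ [y]) @ r'" unfolding lr by simp
    then have "sublist ([y] @ [y]) (rev l @ a # r)" by (metis sublist_appendI)
    then show ?thesis unfolding square_free_def by blast
  next
    case 3
    let ?w = "rev (take 22 l) @ a # take 22 r"
    have "\<not> square_free ?w" using assms(1) 3 unfolding lr by (simp add: contains_square_iff)
    moreover have "rev l @ a # r = rev (drop 22 l) @ ?w @ drop 22 r"
      by (simp add: rev_append[symmetric] del: rev_append)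
    then have "sublist ?w (rev l @ a # r)" by (metis sublist_appendI)
    ultimately show ?thesis using square_free_sublist by blast
  qed
qed

lemma killed_insert:
  assumes "killed l (u @ u') (u @ u' @ m)" "square_free (rev l @ u @ u' @ m)"
  shows "\<not> square_free (rev l @ u @ a # u' @ m)"
  using assms
proof (induction u arbitrary: l)
  case Nil
  then have "killed_at l (u' @ m)" by (cases u') (auto split: if_splits)
  then show ?case using not_square_free_insert Nil by simp
next
  case (Cons y u)
  then show ?case using Cons.IH[of "y # l"] by (auto split: if_splits)
qed

text \<open>The scan starts behind the first letter: the place in front of a block is the last place
  of the preceding block.\<close>

definition killing :: "letter list \<Rightarrow> bool" where
  "killing X \<longleftrightarrow> killed [hd X] (tl X) (tl X @ marker)"

lemma killing_insert:
  assumes "killing (u @ u')" "u \<noteq> []" "square_free (u @ u' @ marker)"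
  shows "\<not> square_free (u @ a # u' @ marker)"
proof -
  obtain x v where u: "u = x # v" using assms(2) by (cases u) auto
  show ?thesis
    using killed_insert[of "[x]" v u' marker a] assms unfolding killing_def u by simp
qed

text \<open>With \<open>u\<close> nonempty, a cut between two blocks belongs to the block on its
  left.\<close>

lemma concat_eq_appendD:
  assumes "concat bs = x @ y" "x \<noteq> []"
  obtains b1 u u' b2 where "bs = b1 @ (u @ u') # b2" "u \<noteq> []" "x = concat b1 @ u" "y = u' @ concat b2"
  using assms
proof (induction bs arbitrary: x thesis)
  case (Cons b bs)
  from Cons.prems(2) obtain t where "b = x @ t \<and> t @ concat bs = y \<or> b @ t = x \<and> concat bs = t @ y"
    by (auto simp: append_eq_append_conv2)
  then consider "b = x @ t" "y = t @ concat bs" | "x = b" "y = concat bs" 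
    | "x = b @ t" "concat bs = t @ y" "t \<noteq> []" by fastforce
  then show ?case
  proof cases
    case 1 then show ?thesis using Cons.prems(1)[of "[]" x t bs] Cons.prems(3) by simp
  next
    case 2 then show ?thesis using Cons.prems(1)[of "[]" x "[]" bs] Cons.prems(3) by simp
  next
    case 3
    obtain b1 u u' b2 where "bs = b1 @ (u @ u') # b2" "u \<noteq> []" "t = concat b1 @ u" "y = u' @ concat b2"
      using Cons.IH[OF _ 3(2,3)] by metis
    then show ?thesis using Cons.prems(1)[of "b # b1" u u' b2] 3 by simp
  qed
qed simp

text \<open>The new square appears in the block followed by a marker. A conjugate passes only once
  around the circle, so this marker has to come from another block; hence at least two
  blocks.\<close>

lemma extremal_if_killing:
  assumes "2 \<le> length bs" "circular_square_free (circular_word (concat bs))"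
    and block: "\<And>X. X \<in> set bs \<Longrightarrow> prefix marker X \<and> killing X \<and> square_free (X @ marker)"
  shows "extremal_square_free (circular_word (concat bs))"
  unfolding extremal_square_free_iff
proof (intro conjI allI impI)
  show "circular_square_free (circular_word (concat bs))" by fact
  have "concat bs \<noteq> []"
  proof -
    obtain b bs' where "bs = b # bs'" using assms(1) by (cases bs) auto
    moreover from this have "b \<noteq> []" using block[of b] by (auto simp: marker_def)
    ultimately show ?thesis by simp
  qed
  fix v a assume "v \<in> circular_word (concat bs)"
  then obtain x y where xy: "concat bs = x @ y" "v = y @ x"
    by (auto simp: circular_word_def conjugate_def)
  \<comment> \<open>A cut in front of the whole word is moved to its end, so that it has a block on
    its left.\<close>
  obtain x' y' where xy': "concat bs = x' @ y'" "v = y' @ x'" "x' \<noteq> []"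
  proof (cases "x = []")
    case True
    then show ?thesis using that[of y "[]"] xy \<open>concat bs \<noteq> []\<close> by simp
  next
    case False
    then show ?thesis using that[of x y] xy by simp
  qed
  obtain b1 u u' b2 where bs: "bs = b1 @ (u @ u') # b2" "u \<noteq> []" "x' = concat b1 @ u"
      "y' = u' @ concat b2"
    using concat_eq_appendD[OF xy'(1,3)] by metis
  have "b2 @ b1 \<noteq> []" using assms(1) unfolding bs(1) by auto
  moreover have "set (b2 @ b1) \<subseteq> set bs" unfolding bs(1) by auto
  ultimately have "prefix marker (concat (b2 @ b1))"
    using block by (cases "b2 @ b1") (auto intro: prefix_prefix simp del: append_eq_Cons_conv)
  then obtain t where t: "concat b2 @ concat b1 = marker @ t" by (auto simp: prefix_def)
  have "\<not> square_free (u @ a # u' @ marker)"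
    using block[of "u @ u'"] killing_insert bs(1,2) by simp
  moreover have "sublist (u @ a # u' @ marker) (u @ a # u' @ concat b2 @ concat b1)"
    unfolding t by (rule prefix_imp_sublist) simp
  ultimately have "\<not> square_free (u @ a # u' @ concat b2 @ concat b1)"
    using square_free_sublist by blast
  moreover have "u @ a # u' @ concat b2 @ concat b1 \<in> circular_word (a # v)"
    using append_commute_circular_word[of u "a # u' @ concat b2 @ concat b1"]
    unfolding xy' bs by (simp add: circular_word_def conjugate_def)
  ultimately show "\<not> circular_square_free (circular_word (a # v))"
    unfolding circular_square_free_def by blast
qed

section \<open>An executable test for explicit words\<close>

definition insert_third :: "nat \<Rightarrow> letter list \<Rightarrow> letter list" where
  "insert_third c v = take c v @ third (last (take c v)) (hd (drop c v)) # drop c v"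

text \<open>The word is rotated under a fixed insertion place with half of the letters, but at most
  20, on its left; short squares around the new letter then appear early in the scanned word. The
  first list only counts rotations.\<close>

fun killed_rotations :: "'a list \<Rightarrow> letter list \<Rightarrow> bool" where
  "killed_rotations [] v = True"
| "killed_rotations (x # xs) v =
    (if circular_square (insert_third (half_length (take 40 v)) v)
     then killed_rotations xs (rotate1 v) else False)"

definition extremal_word :: "letter list \<Rightarrow> bool" where
  "extremal_word w \<longleftrightarrow> (if circular_square w then False else killed_rotations w w)"

lemma killed_rotations_rotate:
  "killed_rotations xs v \<Longrightarrow> i < length xs \<Longrightarrow>
     circular_square (insert_third (half_length (take 40 v)) (rotate i v))"
proof (induction xs arbitrary: i v)
  case (Cons x xs)
  show ?case
  proof (cases i)
    case 0
    then show ?thesis using Cons.prems by (auto split: if_splits)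
  next
    case (Suc j)
    then show ?thesis using Cons.IH[of "rotate1 v" j] Cons.prems
      by (auto simp: rotate1_rotate_swap half_length split: if_splits)
  qed
qed simp

lemma circular_word_eq_rotate:
  assumes "v \<in> circular_word w" "w \<noteq> []"
  shows "\<exists>i<length w. v = rotate i w"
proof -
  obtain x y where xy: "w = x @ y" "v = y @ x"
    using assms(1) by (auto simp: circular_word_def conjugate_def)
  then have "v = rotate (length x) w" by (simp add: rotate_append)
  then have "v = rotate (length x mod length w) w" using rotate_conv_mod by metis
  then show ?thesis using assms(2) by (intro exI[of _ "length x mod length w"]) simp
qed

text \<open>Any insertion place is rotated to position \<open>c\<close>. If the resulting word is
  square-free, the new letter differs from both neighbours, so it is the third one, which was
  tested.\<close>

lemma extremal_if_extremal_word:
  assumes w: "extremal_word w" "2 \<le> length w"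
  shows "extremal_square_free (circular_word w)"
  unfolding extremal_square_free_iff
proof (intro conjI allI impI)
  show csf: "circular_square_free (circular_word w)"
    using w(1) unfolding extremal_word_def circular_square_iff by (simp split: if_splits)
  fix v a assume v: "v \<in> circular_word w"
  define c where "c = half_length (take 40 w)"
  have len: "length v = length w" using v by (rule length_circular_word)
  have c: "0 < c" "c < length w" using w(2) unfolding c_def half_length by auto
  define l where "l = drop (length w - c) v"
  define r where "r = take (length w - c) v"
  have lr: "v = r @ l" "length l = c" "length r = length w - c" unfolding l_def r_def using len c by auto
  have "l @ r \<in> circular_word v" unfolding lr(1) by (rule append_commute_circular_word)
  then have lr_w: "l @ r \<in> circular_word w" using circular_word_sym[OF v] by simp
  moreover have "w \<noteq> []" using w(2) by auto
  ultimately obtain i where i: "i < length w" "l @ r = rotate i w"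
    using circular_word_eq_rotate by blast
  have killed: "circular_square (insert_third c (l @ r))"
    using killed_rotations_rotate[of w w i] w(1) i unfolding c_def extremal_word_def
    by (simp split: if_splits)
  obtain x l' where l: "l = l' @ [x]" using c lr(2) by (cases l rule: rev_cases) auto
  obtain y r' where r: "r = y # r'" using c lr(3) by (cases r) auto
  have av: "circular_word (a # v) = circular_word (l @ a # r)"
    using circular_word_append_commute[of "a # r" l] unfolding lr(1) by simp
  have conj: "l @ a # r \<in> circular_word (a # v)" unfolding av by (rule self_in_circular_word)
  show "\<not> circular_square_free (circular_word (a # v))"
  proof (cases "square_free (l @ a # r)")
    case False
    then show ?thesis using conj unfolding circular_square_free_def by blast
  next
    case True
    have "a \<noteq> x" using square_free_nth_Suc_neq[OF True, of "length l'"] by (auto simp: l nth_append)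
    moreover have "a \<noteq> y" using square_free_nth_Suc_neq[OF True, of "length l"] by (auto simp: r nth_append)
    moreover have "x \<noteq> y"
    proof -
      have "square_free (l @ r)"
        using csf lr_w unfolding circular_square_free_def by blast
      then show ?thesis using square_free_nth_Suc_neq[of "l @ r" "length l'"] by (auto simp: l r nth_append)
    qed
    ultimately have "a = third x y" using third_cases by blast
    moreover have "insert_third c (l @ r) = l @ third (last l) (hd r) # r"
      unfolding insert_third_def lr(2)[symmetric] by simp
    ultimately have "insert_third c (l @ r) = l @ a # r" by (simp add: l r)
    then show ?thesis using killed unfolding av circular_square_iff by simp
  qed
qed



section \<open>Evaluation of the tests and the lengths obtained\<close>

lemma extremal_sporadic_words: "list_all extremal_word sporadic_words"
  by code_simp

text \<open>Connectors alone are used when the length leaves no room for a block; one block is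
  outside the scope of \<open>extremal_if_killing\<close>.\<close>

lemma extremal_connectors: "list_all extremal_word connectors"
  by code_simp

lemma killing_blocks: "list_all killing ([block_a, block_b, block_c] @ connectors)"
  by code_simp

lemma good_connectors: "list_all (\<lambda>D. good_blocks [block_a, block_b, block_c, D]) connectors"
  by code_simp

definition block :: "letter list \<Rightarrow> letter option \<Rightarrow> letter list" where
  "block D x = (case x of None \<Rightarrow> D | Some La \<Rightarrow> block_a | Some Lb \<Rightarrow> block_b | Some Lc \<Rightarrow> block_c)"

lemma length_block: "length (block D (Some x)) = 28"
  by (cases x) (simp_all add: block_def block_a_def block_b_def block_c_def)

lemma distinct_blocks: "list_all (\<lambda>D. distinct [block_a, block_b, block_c, D]) connectors"
  by code_simp

lemma marked_blocks_block:
  assumes D: "D \<in> set connectors"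
  shows "marked_blocks (block D) marker"
proof (rule marked_blocks_if_good_blocks)
  show "good_blocks [block_a, block_b, block_c, D]"
    using good_connectors D by (simp add: list_all_iff)
  show "range (block D) \<subseteq> set [block_a, block_b, block_c, D]"
    unfolding block_def by (auto split: option.splits letter.splits)
  have "distinct [block_a, block_b, block_c, D]" using distinct_blocks D by (simp add: list_all_iff)
  then show "inj (block D)"
    unfolding block_def by (intro injI) (auto split: option.splits letter.splits)
  show "Some La \<noteq> Some Lb" by simp
qed

lemma ex_extremal_of_length:
  assumes D: "D \<in> set connectors" and k: "0 < k"
  shows "\<exists>w :: letter list. length w = length D + 28 * k \<and> extremal_square_free (circular_word w)"
proof -
  interpret marked_blocks "block D" marker by (rule marked_blocks_block[OF D])
  \<comment> \<open>Restricted to \<open>Some\<close>, the same morphism is uniform and maps three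
    letters to words over three letters, so it can be iterated to produce \<open>w\<close>.\<close>
  have "marked_blocks (\<lambda>x. block D (Some x)) marker"
  proof
    show "x = y \<or> x = z" if "block D (Some x) = p @ s" "prefix p (block D (Some y))"
      "suffix s (block D (Some z))" for x y z p s
      using cut[OF that] by simp
  qed (simp_all add: marker marker_occurrence square_free_block square_free_pair)
  then obtain w :: "letter list" where w: "square_free w" "length w = k"
    using ex_square_free_word[of "\<lambda>x. block D (Some x)" marker k] length_block by blast
  let ?bs = "map (block D) (None # map Some w)"
  have "w \<noteq> []" using w(2) k by auto
  have "extremal_square_free (circular_word (concat ?bs))"
  proof (rule extremal_if_killing)
    show "2 \<le> length ?bs" using w(2) k by simp
    show "circular_square_free (circular_word (concat ?bs))"
      by (rule circular_square_free_connected[OF marked_blocks_block[OF D] w(1) \<open>w \<noteq> []\<close>])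
    fix X assume "X \<in> set ?bs"
    then obtain x where x: "X = block D x" by auto
    have "X \<in> set ([block_a, block_b, block_c] @ connectors)"
      using D unfolding x block_def by (auto split: option.splits letter.splits)
    then have "killing X" using killing_blocks unfolding list_all_iff by blast
    then show "prefix marker X \<and> killing X \<and> square_free (X @ marker)"
      using marker(2) square_free_block unfolding x by blast
  qed
  moreover have "length (concat ?bs) = length D + 28 * k"
    using w(2) length_block by (simp add: block_def length_concat o_def sum_list_triv)
  ultimately show ?thesis by blast
qed

lemma length_connectors: "map length connectors = [56, 57, 58, 59, 32, 61, 62, 63, 36, 65, 66, 67,
    40, 69, 70, 43, 72, 45, 46, 47, 48, 49, 50, 51, 52, 53, 54, 55]"
  by (simp add: connectors_def)

lemma length_sporadic_words: "map length sporadic_words = [4, 6, 8, 13, 15, 16, 18, 20, 21, 22, 23,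
    24, 28, 30, 33, 34, 35, 38, 39, 41, 42, 44]"
  by (simp add: sporadic_words_def)

lemma ex_connector_of_length_mod: "\<exists>D\<in>set connectors. length D mod 28 = n mod 28"
proof -
  have "map (\<lambda>l. l mod 28) (map length connectors) = [0..<28]"
    unfolding length_connectors by (simp add: upt_conv_Cons)
  then have "n mod 28 \<in> set (map (\<lambda>l. l mod 28) (map length connectors))" by (simp del: map_map)
  then show ?thesis by auto
qed

lemma ex_extremal_explicit:
  assumes "n \<in> set (map length sporadic_words) \<union> set (map length connectors)"
  shows "\<exists>w :: letter list. length w = n \<and> extremal_square_free (circular_word w)"
proof -
  obtain w where w: "w \<in> set sporadic_words \<union> set connectors" "length w = n"
    using assms by auto
  have "2 \<le> n" using assms unfolding length_sporadic_words length_connectors by auto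
  moreover have "extremal_word w"
    using w(1) extremal_sporadic_words extremal_connectors unfolding list_all_iff by blast
  ultimately show ?thesis using extremal_if_extremal_word w(2) by blast
qed

lemma ex_extremal_ge_38:
  assumes "38 \<le> n"
  shows "\<exists>w :: letter list. length w = n \<and> extremal_square_free (circular_word w)"
proof (cases "n \<in> {38, 39, 41, 42, 44}")
  case True
  then show ?thesis by (intro ex_extremal_explicit) (auto simp: length_sporadic_words)
next
  case False
  obtain D where D: "D \<in> set connectors" "length D mod 28 = n mod 28"
    using ex_connector_of_length_mod by blast
  have "length D \<in> set (map length connectors)" using D(1) by simp
  \<comment> \<open>The connectors with at least 38 + 28 letters have lengths 66, 67, 69, 70 and
    72.\<close>
  then have len: "length D \<le> 72" "length D = n + 28 \<Longrightarrow> n \<in> {38, 39, 41, 42, 44}"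
    using assms unfolding length_connectors by auto
  have "length D \<le> n"
  proof (rule ccontr)
    assume "\<not> length D \<le> n"
    then obtain j where "length D = n + 28 * j" using D(2) by (metis mod_eq_nat1E nat_le_linear)
    \<comment> \<open>The excess is at most 72 - 38 = 34, which leaves a single multiple of
      28.\<close>
    then have "length D = n + 28" using len(1) assms \<open>\<not> length D \<le> n\<close> by (cases j) auto
    then show False using len(2) False by blast
  qed
  then obtain k where k: "n = length D + 28 * k"
    using D(2) by (metis mod_eq_nat1E)
  show ?thesis
  proof (cases "k = 0")
    case True
    then show ?thesis using D(1) k by (intro ex_extremal_explicit) simp
  next
    case False
    then show ?thesis using ex_extremal_of_length[OF D(1), of k] k by simp
  qed
qed

theorem theorem3:
  fixes n :: nat
  shows "(\<exists>w :: letter list. length w = n \<and> extremal_square_free (circular_word w)) \<longleftrightarrow>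
    n \<in> {4, 6, 8, 13, 15, 16, 18, 20, 21, 22, 23, 24, 28, 30, 32, 33, 34, 35, 36} \<union> {m. m \<ge> 38}"
    (is "?ex \<longleftrightarrow> n \<in> ?S")
proof
  assume ex: ?ex
  show "n \<in> ?S"
  proof (rule ccontr)
    assume "n \<notin> ?S"
    then have "n \<in> {0, 1} \<union> set gaps" unfolding gaps_def by simp presburger
    then show False using ex not_extremal_gap by blast
  qed
next
  assume n: "n \<in> ?S"
  show ?ex
  proof (cases "38 \<le> n")
    case True
    then show ?thesis by (rule ex_extremal_ge_38)
  next
    case False
    then show ?thesis
      using n by (intro ex_extremal_explicit) (auto simp: length_sporadic_words length_connectors)
  qed
qed

end
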